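(* Let $P:L^2(\overline{\mathcal{R}},d\omega)\to\mathcal{M}^2_\omega(\mathcal{R})$ be the orthogonal projection. Then, for every $1\le p<\infty$ with $p\ne2$, $P$ is unbounded as an operator $$P:L^p(\overline{\mathcal{R}},d\omega)\cap L^2(\overline{\mathcal{R}},d\omega)\to\mathcal{M}^p_\omega(\mathcal{R}),$$ that is, there is no constant $C$ such that $Pf\in\mathcal{M}^p_\omega(\mathcal{R})$ and $\|Pf\|_{L^p(\overline{\mathcal{R}},d\omega)}\le C\|f\|_{L^p(\overline{\mathcal{R}},d\omega)}$ for all $f\in L^p(\overline{\mathcal{R}},d\omega)\cap L^2(\overline{\mathcal{R}},d\omega)$.
   Context: $\mathcal{R}=\{z\in\mathbf{C}:\Re z>0\}$, $\overline{\mathcal{R}}$ its closure. For $0<b<\infty$ and $1\le p<\infty$, $S_b=\{x+iy:0<x<b\}$ and $H^p(S_b)$ is the space of holomorphic $f$ on $S_b$ with $\sup_{0<x<b}\int_{-\infty}^{+\infty}|f(x+iy)|^p\,dy<\infty$; such functions have $p$-integrable boundary values on the imaginary axis. Let $\omega=\sum_{n=0}^{+\infty}\frac{2^n}{n!}\,\delta_{n/2}(x)\otimes dy$ on $\overline{\mathcal{R}}$, so $\|f\|^p_{L^p(\overline{\mathcal{R}},d\omega)}=\sum_{n\ge0}\frac{2^n}{n!}\int_{-\infty}^{+\infty}|f(\frac n2+iy)|^p\,dy$. $\mathcal{M}^p_\omega(\mathcal{R})$ is the space of holomorphic functions $f$ on $\mathcal{R}$ such that $f\in H^p(S_b)$ for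 all $b>0$ and $f\in L^p(\overline{\mathcal{R}},d\omega)$ (boundary values used on the imaginary axis), with the $L^p(\overline{\mathcal{R}},d\omega)$ norm. $\mathcal{M}^2_\omega(\mathcal{R})$ is a closed subspace of $L^2(\overline{\mathcal{R}},d\omega)$. *)

theory Defs
  imports "HOL-Complex_Analysis.Complex_Analysis"
begin

definition right_half_plane :: "complex set" where
  "right_half_plane = {z. Re z > 0}"

definition strip :: "real \<Rightarrow> complex set" where
  "strip b = {z. 0 < Re z \<and> Re z < b}"

definition hardy_strip :: "real \<Rightarrow> real \<Rightarrow> (complex \<Rightarrow> complex) set" where
  "hardy_strip p b = {f. f holomorphic_on strip b \<and>
     (SUP x\<in>{0<..<b}. \<integral>\<^sup>+y. ennreal (norm (f (Complex x y)) powr p) \<partial>lborel) < \<infinity>}"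

definition omega_radial :: "real measure" where
  "omega_radial = distr (density (count_space UNIV) (\<lambda>n::nat. ennreal (2 ^ n / fact n)))
     borel (\<lambda>n. real n / 2)"

definition omega :: "complex measure" where
  "omega = restrict_space
     (distr (omega_radial \<Otimes>\<^sub>M lborel) borel (\<lambda>(x, y). Complex x y))
     (closure right_half_plane)"

lemma closure_right_half_plane: "closure right_half_plane = {z. Re z \<ge> 0}"
  using closure_halfspace_gt[of "1::complex" 0]
  by (simp add: right_half_plane_def inner_complex_def)

lemma space_omega: "space omega = {z. Re z \<ge> 0}"
  by (simp add: omega_def space_restrict_space closure_right_half_plane)

lemma nn_integral_omega:
  assumes [measurable]: "f \<in> borel_measurable borel"
  shows "(\<integral>\<^sup>+z. f z \<partial>omega) =
    (\<Sum>n. ennreal (2 ^ n / fact n) * (\<integral>\<^sup>+y. f (Complex (real n / 2) y) \<partial>lborel))"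
proof -
  have [measurable]: "(\<lambda>(x, y). Complex x y) \<in> borel \<Otimes>\<^sub>M borel \<rightarrow>\<^sub>M borel"
    unfolding borel_prod
    by (intro borel_measurable_continuous_onI) (simp add: Complex_eq case_prod_unfold; intro continuous_intros)
  have s [measurable_cong]: "sets omega_radial = sets borel"
    by (simp add: omega_radial_def)
  have [measurable]: "{z::complex. Re z \<ge> 0} \<in> sets borel"
    using closed_halfspace_Re_ge by (rule borel_closed)
  have "(\<integral>\<^sup>+z. f z \<partial>omega) =
    (\<integral>\<^sup>+z. f z * indicator {z. Re z \<ge> 0} z
       \<partial>distr (omega_radial \<Otimes>\<^sub>M lborel) borel (\<lambda>(x, y). Complex x y))"
    unfolding omega_def closure_right_half_plane by (subst nn_integral_restrict_space) auto
  also have "\<dots> = (\<integral>\<^sup>+w. f (Complex (fst w) (snd w)) * indicator {z. Re z \<ge> 0} (Complex (fst w) (snd w))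
       \<partial>(omega_radial \<Otimes>\<^sub>M lborel))"
    by (subst nn_integral_distr) (auto simp: case_prod_unfold)
  also have "\<dots> = (\<integral>\<^sup>+x. (\<integral>\<^sup>+y. f (Complex x y) * indicator {z. Re z \<ge> 0} (Complex x y) \<partial>lborel) \<partial>omega_radial)"
    by (subst lborel.nn_integral_fst[symmetric]) auto
  also have "\<dots> = (\<integral>\<^sup>+n. ennreal (2 ^ n / fact n) *
       (\<integral>\<^sup>+y. f (Complex (real n / 2) y) * indicator {z. Re z \<ge> 0} (Complex (real n / 2) y) \<partial>lborel)
       \<partial>count_space UNIV)"
    unfolding omega_radial_def
    by (subst nn_integral_distr) (auto simp: nn_integral_density)
  also have "\<dots> = (\<Sum>n. ennreal (2 ^ n / fact n) * (\<integral>\<^sup>+y. f (Complex (real n / 2) y) \<partial>lborel))"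
    by (simp add: nn_integral_count_space_nat)
  finally show ?thesis .
qed

definition Lp :: "real \<Rightarrow> 'a measure \<Rightarrow> ('a \<Rightarrow> complex) set" where
  "Lp p M = {f \<in> borel_measurable M. integrable M (\<lambda>z. norm (f z) powr p)}"

definition Lp_norm :: "real \<Rightarrow> 'a measure \<Rightarrow> ('a \<Rightarrow> complex) \<Rightarrow> real" where
  "Lp_norm p M f = (\<integral>z. norm (f z) powr p \<partial>M) powr (1 / p)"

definition L2_inner :: "'a measure \<Rightarrow> ('a \<Rightarrow> complex) \<Rightarrow> ('a \<Rightarrow> complex) \<Rightarrow> complex" where
  "L2_inner M f g = (\<integral>z. f z * cnj (g z) \<partial>M)"

text \<open>
  An element of the space is represented by a function on the closed half-plane whose values
  on the imaginary axis are the boundary values of its restriction to the open half-plane,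
  i.e. almost everywhere the limits along horizontal segments. Almost everywhere existence
  of these limits is automatic for functions that are in the Hardy space of a strip.
\<close>
definition M_omega :: "real \<Rightarrow> (complex \<Rightarrow> complex) set" where
  "M_omega p = {f. f holomorphic_on right_half_plane \<and>
     (\<forall>b>0. f \<in> hardy_strip p b) \<and>
     (AE y in lborel. ((\<lambda>x. f (Complex x y)) \<longlongrightarrow> f (Complex 0 y)) (at_right 0)) \<and>
     f \<in> Lp p omega}"

text \<open>
  Since \<open>M_omega 2\<close> is a closed subspace of \<open>Lp 2 omega\<close>, the projection exists for every \<open>f\<close>
  in \<open>Lp 2 omega\<close>; it is unique on the open half-plane and almost everywhere on the imaginary
  axis, so nothing below depends on the choice made by \<open>SOME\<close>.
\<close>
definition omega_proj :: "(complex \<Rightarrow> complex) \<Rightarrow> complex \<Rightarrow> complex" where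
  "omega_proj f = (SOME h. h \<in> M_omega 2 \<and>
     (\<forall>g\<in>M_omega 2. L2_inner omega (\<lambda>z. f z - h z) g = 0))"

end

theory Submission
  imports Defs "HOL-Probability.Sinc_Integral"
begin

text \<open>
  The projection can be computed explicitly on a family of functions. Let \<open>f\<^sub>k\<close> be concentrated on
  the line \<open>Re z = k\<close>, with value \<open>\<Gamma>(1 + iy)\<close> there divided by the weight \<open>4\<^sup>k / (2k)!\<close> of this line.
  Then \<open>P f\<^sub>k = h\<^sub>k\<close>, where \<open>h\<^sub>k(z)\<close> is \<open>\<Gamma>(z + k + 1)\<close> divided by \<open>3\<close> to the power \<open>z + k + 1\<close>.

  To see this, pair \<open>h\<^sub>k\<close> with some \<open>g\<close> in the subspace. On the line \<open>Re w = m/2\<close> the conjugate of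
  \<open>w\<close> is \<open>m - w\<close>, so the pairing on this line is a contour integral of a holomorphic function and may
  be moved to the line \<open>Re w = k\<close>. There \<open>h\<^sub>k\<close> appears at \<open>m - k + iy\<close>, and the sum
  over \<open>m\<close> with weights \<open>2\<^sup>m / m!\<close> is a binomial series with value \<open>\<Gamma>(1 + iy)\<close>
  (\<open>Gamma_binomial_series\<close>). So \<open>h\<^sub>k\<close> and \<open>f\<^sub>k\<close> have the same inner product with every \<open>g\<close>
  (\<open>gamma_shift_orthogonal\<close>). The analytic work lies in the contour shift
  (\<open>vertical_integral_product_eq\<close>), which must include the boundary line \<open>Re w = 0\<close>, where \<open>g\<close>
  is only an almost everywhere limit.

  Now compare norms. Up to geometric factors, the \<open>p\<close>-th power of the norm of \<open>f\<^sub>k\<close> is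
  \<open>k!\<close> to the power \<open>2(p - 1)\<close>, while the line \<open>Re z = j\<close> contributes to that of \<open>h\<^sub>k\<close> at least
  \<open>(k + j)!\<close> to the power \<open>p\<close>, divided by \<open>(j!)\<^sup>2\<close>. With \<open>j = 0\<close> the quotient is \<open>k!\<close> to the power
  \<open>2 - p\<close>, which beats every geometric sequence if \<open>p < 2\<close>. With \<open>k = 0\<close> it is \<open>j!\<close> to
  the power \<open>p - 2\<close>, which does so if \<open>p > 2\<close>.
\<close>

section \<open>Bounds and a binomial series for the Gamma function\<close>

lemma norm_Gamma_le_Gamma_Re:
  assumes "Re z > 0"
  shows "norm (Gamma z) \<le> Gamma (Re z)"
proof -
  let ?f = "\<lambda>t. complex_of_real t powr (z - 1) / complex_of_real (exp t)"
  let ?g = "\<lambda>t. t powr (Re z - 1) / exp t"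
  have f: "(?f has_integral Gamma z) {0..}"
    using assms by (rule Gamma_integral_complex)
  have g: "(?g has_integral Gamma (Re z)) {0..}"
    using assms by (rule Gamma_integral_real)
  have "norm (integral {0..} ?f) \<le> integral {0..} ?g"
    using f g by (intro integral_norm_bound_integral)
      (auto simp: has_integral_iff norm_divide norm_powr_real_powr)
  then show ?thesis
    using f g by (simp add: integral_unique)
qed

text \<open>Two applications of the functional equation give
  \<open>\<Gamma>(z) = \<Gamma>(z + 2) / (z (z + 1))\<close>, and the denominator has size at least \<open>(1 + y\<^sup>2) / 2\<close>. This
  polynomial decay is far from the exponential truth, but it makes every integral below converge.\<close>

lemma norm_Gamma_decay:
  assumes "x \<ge> 1/2"
  shows "norm (Gamma (Complex x y)) \<le> 2 * Gamma (x + 2) / (1 + y\<^sup>2)"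
proof -
  let ?z = "Complex x y"
  have nz: "?z \<noteq> 0" "?z + 1 \<noteq> 0"
    using assms by (auto simp: complex_eq_iff)
  have "Gamma (?z + 2) = (?z + 1) * (?z * Gamma ?z)"
  proof -
    have "?z \<notin> \<int>\<^sub>\<le>\<^sub>0" "?z + 1 \<notin> \<int>\<^sub>\<le>\<^sub>0"
      using assms by (auto elim!: nonpos_Ints_cases simp: complex_eq_iff)
    then show ?thesis
      using Gamma_plus1[of "?z + 1"] Gamma_plus1[of ?z] by (simp add: add.assoc nz)
  qed
  then have "norm ((?z + 1) * ?z) * norm (Gamma ?z) = norm (Gamma (?z + 2))"
    by (simp add: norm_mult)
  also have "\<dots> \<le> Gamma (x + 2)"
    using norm_Gamma_le_Gamma_Re[of "?z + 2"] assms by simp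
  finally have 1: "norm ((?z + 1) * ?z) * norm (Gamma ?z) \<le> Gamma (x + 2)" .
  have "((1 + y\<^sup>2) / 2)\<^sup>2 = (1 + y\<^sup>2) * ((1 + y\<^sup>2) / 4)"
    by (simp add: power2_eq_square)
  also have "\<dots> \<le> ((x + 1)\<^sup>2 + y\<^sup>2) * (x\<^sup>2 + y\<^sup>2)"
  proof (rule mult_mono)
    show "1 + y\<^sup>2 \<le> (x + 1)\<^sup>2 + y\<^sup>2"
      using assms by (simp add: one_le_power)
    have "(1/2)\<^sup>2 \<le> x\<^sup>2"
      using assms by (intro power_mono) auto
    then have "1/4 \<le> x\<^sup>2" by (simp add: power_divide)
    moreover have "y\<^sup>2 / 4 \<le> y\<^sup>2" by simp
    ultimately show "(1 + y\<^sup>2) / 4 \<le> x\<^sup>2 + y\<^sup>2"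
      unfolding add_divide_distrib by (rule add_mono)
  qed auto
  also have "\<dots> = (norm ((?z + 1) * ?z))\<^sup>2"
    by (simp add: norm_mult power_mult_distrib cmod_power2)
  finally have "(1 + y\<^sup>2) / 2 \<le> norm ((?z + 1) * ?z)"
    by (rule power2_le_imp_le) simp
  then have "(1 + y\<^sup>2) / 2 * norm (Gamma ?z) \<le> Gamma (x + 2)"
    using 1 by (meson mult_right_mono norm_ge_zero order_trans)
  moreover have "1 + y\<^sup>2 > 0"
    by (simp add: add_pos_nonneg)
  ultimately show ?thesis
    by (simp add: field_simps)
qed

text \<open>Each factor in \<open>\<Gamma>(n + 1 + iy) = (n + iy) \<cdots> (1 + iy) \<Gamma>(1 + iy)\<close> is at least its real
  part. This is the factorial growth to the right that makes the projection unbounded.\<close>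

lemma norm_Gamma_vertical_line_ge:
  "fact n * norm (Gamma (Complex 1 y)) \<le> norm (Gamma (Complex (real n + 1) y))"
proof (induction n)
  case (Suc n)
  let ?z = "Complex (real n + 1) y"
  have "?z \<notin> \<int>\<^sub>\<le>\<^sub>0"
    by (auto elim!: nonpos_Ints_cases simp: complex_eq_iff)
  then have "Gamma (?z + 1) = ?z * Gamma ?z"
    by (rule Gamma_plus1)
  moreover have "?z + 1 = Complex (real (Suc n) + 1) y"
    by (simp add: complex_eq_iff)
  ultimately have "norm (Gamma (Complex (real (Suc n) + 1) y)) = norm ?z * norm (Gamma ?z)"
    by (simp add: norm_mult)
  also have "\<dots> \<ge> real (Suc n) * (fact n * norm (Gamma (Complex 1 y)))"
    using complex_Re_le_cmod[of ?z] Suc.IH by (intro mult_mono) auto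
  finally show ?case by (simp add: algebra_simps)
qed simp

text \<open>Log-convexity at the midpoint \<open>x\<close> of \<open>1\<close> and \<open>2x - 1\<close>. At \<open>x = m/2 + O(1)\<close> it shows that
  \<open>\<Gamma>(x)\<^sup>2\<close> is at most \<open>m!\<close> up to a power of \<open>m\<close>, so that it is absorbed by the weight \<open>1 / m!\<close> of the line \<open>Re z = m/2\<close>.\<close>

lemma Gamma_real_square_le:
  assumes "x > (1/2::real)"
  shows "(Gamma x)\<^sup>2 \<le> Gamma (2 * x - 1)"
proof -
  have pos: "Gamma x > 0" "Gamma (2 * x - 1) > 0"
    using assms by (auto intro!: Gamma_real_pos)
  have "(ln \<circ> Gamma) ((1 - 1/2) *\<^sub>R 1 + (1/2) *\<^sub>R (2 * x - 1))
      \<le> (1 - 1/2) * (ln \<circ> Gamma) 1 + (1/2) * (ln \<circ> Gamma) (2 * x - 1)"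
    using assms by (intro convex_onD[OF log_convex_Gamma_real]) auto
  then have "2 * ln (Gamma x) \<le> ln (Gamma (2 * x - 1))"
    by (simp add: field_simps)
  then have "ln ((Gamma x)\<^sup>2) \<le> ln (Gamma (2 * x - 1))"
    using pos by (simp add: ln_realpow)
  moreover have "(Gamma x)\<^sup>2 > 0"
    using pos by simp
  ultimately show ?thesis
    using pos(2) by simp
qed

lemma pochhammer_binomial_series:
  fixes a z :: complex
  assumes "norm z < 1"
  shows "(\<lambda>n. pochhammer a n / fact n * z ^ n) sums (1 - z) powr (- a)"
proof -
  have "(\<lambda>n. ((- a) gchoose n) * (- z) ^ n) sums (1 + (- z)) powr (- a)"
    using assms by (intro gen_binomial_complex) simp
  moreover have "((- a) gchoose n) * (- z) ^ n = pochhammer a n / fact n * z ^ n" for n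
  proof -
    have "(-1 :: complex) ^ n * (- z) ^ n = z ^ n"
      by (simp flip: power_mult_distrib)
    then show ?thesis by (simp add: gbinomial_pochhammer)
  qed
  ultimately show ?thesis by simp
qed

text \<open>Since \<open>\<Gamma>(s + m) = (s)\<^sub>m \<Gamma>(s)\<close>, this is the binomial series of \<open>(1 - 2/3)\<close> to the power
  \<open>-s\<close>, which cancels the factor \<open>3\<close> to the power \<open>-s\<close>. In terms of the Euler integral,
  the function \<open>\<Gamma>(s)\<close> divided by the \<open>s\<close>-th power of \<open>c\<close> corresponds to the density
  \<open>exp(-cu)\<close>; the sum over \<open>m\<close> with weights \<open>2\<^sup>m / m!\<close> multiplies the density by \<open>exp(2u)\<close>,
  turning \<open>c = 3\<close> into \<open>c = 1\<close>.\<close>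

lemma Gamma_binomial_series:
  assumes "Re s > 0"
  shows "(\<lambda>m. 2 ^ m / fact m * (Gamma (s + of_nat m) * 3 powr - (s + of_nat m))) sums Gamma s"
proof -
  have s: "s \<notin> \<int>\<^sub>\<le>\<^sub>0"
    using assms by (auto elim!: nonpos_Ints_cases)
  have "(\<lambda>m. Gamma s * 3 powr - s * (pochhammer s m / fact m * (2/3) ^ m))
     sums (Gamma s * 3 powr - s * (1 - 2/3) powr (- s))"
    by (intro sums_mult pochhammer_binomial_series) simp
  moreover have "(3::complex) powr - s * (1 - 2/3) powr (- s) = 1"
  proof -
    have "Ln (1/3 :: complex) = - Ln 3"
      using Ln_inverse[of "3::complex"] by (simp add: field_simps)
    then show ?thesis by (simp add: powr_def flip: exp_add)
  qed
  moreover have "Gamma s * 3 powr - s * (pochhammer s m / fact m * (2/3) ^ m)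
     = 2 ^ m / fact m * (Gamma (s + of_nat m) * 3 powr - (s + of_nat m))" for m
  proof -
    have "(3::complex) powr - (s + of_nat m) = 3 powr - s / 3 ^ m"
      by (simp add: powr_diff powr_nat' powr_minus)
    moreover have "Gamma s * pochhammer s m = Gamma (s + of_nat m)"
      using s by (simp add: pochhammer_Gamma Gamma_eq_zero_iff)
    ultimately show ?thesis
      by (simp add: field_simps)
  qed
  ultimately show ?thesis by (simp add: mult.assoc)
qed

lemma summable_Gamma_series:
  assumes "a > 0"
  shows "summable (\<lambda>m. 2 ^ m / fact m * (Gamma (a + real m) * (1/3) ^ m))"
proof -
  have "summable (\<lambda>m. 2 ^ m / fact m * (Gamma (of_real a + of_nat m) * 3 powr - (of_real a + of_nat m)) :: complex)"
    using assms by (intro sums_summable[OF Gamma_binomial_series]) simp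
  moreover have "2 ^ m / fact m * (Gamma (of_real a + of_nat m) * 3 powr - (of_real a + of_nat m))
     = (of_real (2 ^ m / fact m * (Gamma (a + real m) * (1/3) ^ m) * 3 powr - a) :: complex)" for m
  proof -
    have *: "(of_real a + of_nat m :: complex) = of_real (a + real m)" by simp
    have "(3::complex) powr - of_real (a + real m) = of_real (3 powr - (a + real m))"
      by (metis Reals_numeral of_real_minus of_real_numeral powr_of_real zero_le_numeral)
    moreover have "3 powr - (a + real m) = 3 powr - a * (1/3) ^ m"
      by (simp add: powr_diff powr_realpow power_divide)
    ultimately show ?thesis unfolding * Gamma_complex_of_real by (simp add: mult_ac)
  qed
  ultimately have "summable (\<lambda>m. 2 ^ m / fact m * (Gamma (a + real m) * (1/3) ^ m) * 3 powr - a)"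
    by (simp only: summable_of_real_iff)
  from summable_mult2[OF this, of "3 powr a"] show ?thesis
    by (simp add: mult.assoc flip: powr_add)
qed

lemma integrable_cauchy_density: "integrable lborel (\<lambda>y::real. 1 / (1 + y\<^sup>2))"
  using integrable_inverse_1_plus_square by (simp add: set_integrable_def inverse_eq_divide)

section \<open>Vertical line integrals of holomorphic functions\<close>

lemma measurable_Complex [measurable]: "(\<lambda>y. Complex x y) \<in> borel \<rightarrow>\<^sub>M borel"
  by (intro borel_measurable_continuous_onI) (simp add: Complex_eq; intro continuous_intros)

text \<open>Boundedness in \<open>L\<^sup>2\<close> of a finite measure gives uniform integrability. Concretely, the difference
  \<open>d\<close> satisfies \<open>d \<le> min d R + d\<^sup>2 / R\<close>: the integral of the first part tends to
  \<open>0\<close> by dominated convergence, that of the second is uniformly small for large \<open>R\<close>. The lemma carries integrals over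
  interior vertical lines to the boundary line, where only almost everywhere convergence is known.\<close>

lemma (in finite_measure) integral_tendsto_of_L2_bounded:
  fixes u :: "nat \<Rightarrow> 'a \<Rightarrow> complex"
  assumes [measurable]: "\<And>n. u n \<in> borel_measurable M" "v \<in> borel_measurable M"
    and lim: "AE x in M. (\<lambda>n. u n x) \<longlonglongrightarrow> v x"
    and bu: "\<And>n. (\<integral>\<^sup>+x. ennreal ((norm (u n x))\<^sup>2) \<partial>M) \<le> ennreal K"
    and bv: "(\<integral>\<^sup>+x. ennreal ((norm (v x))\<^sup>2) \<partial>M) \<le> ennreal K"
  shows "(\<lambda>n. \<integral>x. u n x \<partial>M) \<longlonglongrightarrow> (\<integral>x. v x \<partial>M)"
proof -
  define d where "d n x = norm (u n x - v x)" for n x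
  have [measurable]: "d n \<in> borel_measurable M" for n
    unfolding d_def by measurable
  have sq: "integrable M (\<lambda>x. (norm (w x))\<^sup>2)"
    if [measurable]: "w \<in> borel_measurable M" and "(\<integral>\<^sup>+x. ennreal ((norm (w x))\<^sup>2) \<partial>M) \<le> ennreal K" for w :: "'a \<Rightarrow> complex"
    using that(2) by (intro integrableI_bounded) (auto intro: le_less_trans)
  have int: "integrable M w"
    if [measurable]: "w \<in> borel_measurable M" and "(\<integral>\<^sup>+x. ennreal ((norm (w x))\<^sup>2) \<partial>M) \<le> ennreal K" for w :: "'a \<Rightarrow> complex"
    using square_integrable_imp_integrable[of "\<lambda>x. norm (w x)"] sq[OF that]
    by (simp add: integrable_norm_iff)
  have sqb: "(\<integral>x. (norm (w x))\<^sup>2 \<partial>M) \<le> max K 0"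
    if [measurable]: "w \<in> borel_measurable M" and "(\<integral>\<^sup>+x. ennreal ((norm (w x))\<^sup>2) \<partial>M) \<le> ennreal K" for w :: "'a \<Rightarrow> complex"
    using that(2) sq[OF that] by (subst (asm) nn_integral_eq_integral) (auto simp: ennreal_le_iff2)
  have d2: "(d n x)\<^sup>2 \<le> 2 * (norm (u n x))\<^sup>2 + 2 * (norm (v x))\<^sup>2" for n x
  proof -
    have "(d n x)\<^sup>2 \<le> (norm (u n x) + norm (v x))\<^sup>2"
      unfolding d_def by (intro power_mono norm_triangle_ineq4) auto
    also have "\<dots> \<le> 2 * (norm (u n x))\<^sup>2 + 2 * (norm (v x))\<^sup>2"
      using sum_squares_bound[of "norm (u n x)" "norm (v x)"] by (simp add: power2_sum)
    finally show ?thesis .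
  qed
  have su: "integrable M (\<lambda>x. (norm (u n x))\<^sup>2)" for n
    by (rule sq[OF _ bu]) simp
  have sv: "integrable M (\<lambda>x. (norm (v x))\<^sup>2)"
    by (rule sq[OF _ bv]) simp
  have id2: "integrable M (\<lambda>x. (d n x)\<^sup>2)" for n
  proof (rule Bochner_Integration.integrable_bound)
    show "integrable M (\<lambda>x. 2 * (norm (u n x))\<^sup>2 + 2 * (norm (v x))\<^sup>2)"
      using su[of n] sv by simp
  qed (use d2 in auto)
  have id: "integrable M (d n)" for n
    using square_integrable_imp_integrable[of "d n"] id2 by simp
  define K' where "K' = 4 * max K 0"
  have bd2: "(\<integral>x. (d n x)\<^sup>2 \<partial>M) \<le> K'" for n
  proof -
    have "(\<integral>x. (d n x)\<^sup>2 \<partial>M) \<le> (\<integral>x. 2 * (norm (u n x))\<^sup>2 + 2 * (norm (v x))\<^sup>2 \<partial>M)"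
      using d2 by (intro integral_mono id2) (use su[of n] sv in auto)
    also have "\<dots> = 2 * (\<integral>x. (norm (u n x))\<^sup>2 \<partial>M) + 2 * (\<integral>x. (norm (v x))\<^sup>2 \<partial>M)"
      using su[of n] sv by simp
    also have "\<dots> \<le> K'"
      using sqb[OF _ bu, of n] sqb[OF _ bv] by (simp add: K'_def)
    finally show ?thesis .
  qed
  have "(\<lambda>n. \<integral>x. d n x \<partial>M) \<longlonglongrightarrow> 0"
  proof (rule LIMSEQ_I)
    fix e :: real assume e: "e > 0"
    \<comment> \<open>chosen so that the tail \<open>d\<^sup>2 / R\<close> has integral below \<open>e / 2\<close>\<close>
    define R where "R = 2 * (K' + 1) / e"
    have R: "R > 0" "K' / R < e / 2"
      using e by (auto simp: R_def K'_def field_simps add_nonneg_pos)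
    have im: "integrable M (\<lambda>x. min (d n x) R)" for n
      by (rule Bochner_Integration.integrable_bound[OF id[of n]]) (use R in \<open>auto simp: d_def\<close>)
    have "(\<lambda>n. \<integral>x. min (d n x) R \<partial>M) \<longlonglongrightarrow> (\<integral>x. 0 \<partial>M)"
    proof (rule integral_dominated_convergence[where w = "\<lambda>_. R"])
      show "AE x in M. (\<lambda>n. min (d n x) R) \<longlonglongrightarrow> 0"
        using lim
      proof eventually_elim
        case (elim x)
        then have "(\<lambda>n. d n x) \<longlonglongrightarrow> 0"
          unfolding d_def using tendsto_norm_zero LIM_zero by blast
        from tendsto_min[OF this tendsto_const[of R]] show ?case
          using R by simp
      qed
    qed (use R in \<open>auto simp: d_def\<close>)
    then obtain N where N: "\<And>n. n \<ge> N \<Longrightarrow> \<bar>\<integral>x. min (d n x) R \<partial>M\<bar> < e / 2"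
      using LIMSEQ_D[of _ 0 "e / 2"] e by fastforce
    show "\<exists>N. \<forall>n\<ge>N. norm ((\<integral>x. d n x \<partial>M) - 0) < e"
    proof (intro exI allI impI)
      fix n assume n: "n \<ge> N"
      have "d n x \<le> min (d n x) R + (d n x)\<^sup>2 / R" for x
      proof (cases "d n x \<le> R")
        case False
        then have "d n x * R \<le> d n x * d n x"
          using R by (intro mult_left_mono) auto
        then have "d n x \<le> (d n x)\<^sup>2 / R"
          using R by (simp add: field_simps power2_eq_square)
        then show ?thesis using False R by simp
      qed (use R in auto)
      then have "(\<integral>x. d n x \<partial>M) \<le> (\<integral>x. min (d n x) R + (d n x)\<^sup>2 / R \<partial>M)"
        by (intro integral_mono id Bochner_Integration.integrable_add im) (auto intro!: id2)
      also have "\<dots> = (\<integral>x. min (d n x) R \<partial>M) + (\<integral>x. (d n x)\<^sup>2 \<partial>M) / R"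
        by (subst Bochner_Integration.integral_add) (auto intro!: im id2)
      also have "\<dots> \<le> (\<integral>x. min (d n x) R \<partial>M) + K' / R"
        using bd2[of n] R by (simp add: divide_right_mono)
      also have "\<dots> < e"
        using N[OF n] R by linarith
      finally have "(\<integral>x. d n x \<partial>M) < e" .
      moreover have "(\<integral>x. d n x \<partial>M) \<ge> 0"
        by (simp add: d_def)
      ultimately show "norm ((\<integral>x. d n x \<partial>M) - 0) < e"
        by simp
    qed
  qed
  moreover have "norm ((\<integral>x. u n x \<partial>M) - (\<integral>x. v x \<partial>M)) \<le> (\<integral>x. d n x \<partial>M)" for n
  proof -
    have "(\<integral>x. u n x \<partial>M) - (\<integral>x. v x \<partial>M) = (\<integral>x. u n x - v x \<partial>M)"
      by (subst Bochner_Integration.integral_diff) (auto intro!: int bu bv)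
    then show ?thesis
      unfolding d_def by simp
  qed
  ultimately have "(\<lambda>n. (\<integral>x. u n x \<partial>M) - (\<integral>x. v x \<partial>M)) \<longlonglongrightarrow> 0"
    by (rule Lim_null_comparison[OF always_eventually, rotated, OF _ allI])
  then show ?thesis by (rule LIM_zero_cancel)
qed

lemma norm_contour_integral_horizontal_le:
  assumes "continuous_on (closed_segment (Complex x1 T) (Complex x2 T)) F" "x1 \<le> x2"
  shows "ennreal (norm (contour_integral (linepath (Complex x1 T) (Complex x2 T)) F))
    \<le> ennreal (x2 - x1) * (\<integral>\<^sup>+t\<in>{0..1}. ennreal (norm (F (Complex (x1 + t * (x2 - x1)) T))) \<partial>lborel)"
proof -
  let ?\<phi> = "\<lambda>t. F (Complex (x1 + t * (x2 - x1)) T)"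
  have lp: "linepath (Complex x1 T) (Complex x2 T) t = Complex (x1 + t * (x2 - x1)) T" for t
    by (simp add: linepath_def complex_eq_iff algebra_simps)
  have cont: "continuous_on {0..1} ?\<phi>"
  proof -
    have "continuous_on {0..1} (F \<circ> linepath (Complex x1 T) (Complex x2 T))"
      using assms(1) by (intro continuous_on_compose continuous_on_linepath) (simp add: linepath_image_01)
    then show ?thesis by (simp add: lp o_def)
  qed
  then have si: "set_integrable lborel {0..1} ?\<phi>"
    unfolding set_integrable_def by (intro borel_integrable_compact) auto
  have "contour_integral (linepath (Complex x1 T) (Complex x2 T)) F
     = integral {0..1} ?\<phi> * (Complex x2 T - Complex x1 T)"
    by (simp add: contour_integral_integral lp)
  also have "Complex x2 T - Complex x1 T = of_real (x2 - x1)"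
    by (simp add: complex_eq_iff)
  also have "integral {0..1} ?\<phi> = (LINT t:{0..1}|lborel. ?\<phi> t)"
    using si by (simp add: set_borel_integral_eq_integral)
  finally have "norm (contour_integral (linepath (Complex x1 T) (Complex x2 T)) F)
      = (x2 - x1) * norm (LINT t:{0..1}|lborel. ?\<phi> t)"
    using assms(2) by (simp add: norm_mult del: of_real_diff)
  also have "ennreal \<dots> = ennreal (x2 - x1) * ennreal (norm (LINT t:{0..1}|lborel. ?\<phi> t))"
    using assms(2) by (simp add: ennreal_mult)
  also have "\<dots> \<le> ennreal (x2 - x1) * (\<integral>\<^sup>+t. ennreal (norm (indicator {0..1} t *\<^sub>R ?\<phi> t)) \<partial>lborel)"
    using si unfolding set_lebesgue_integral_def set_integrable_def
    by (intro mult_left_mono integral_norm_bound_ennreal) auto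
  also have "(\<integral>\<^sup>+t. ennreal (norm (indicator {0..1} t *\<^sub>R ?\<phi> t)) \<partial>lborel)
     = (\<integral>\<^sup>+t\<in>{0..1}. ennreal (norm (?\<phi> t)) \<partial>lborel)"
    by (intro nn_integral_cong) (auto split: split_indicator)
  finally show ?thesis .
qed

lemma contour_integral_rectangle:
  assumes F: "F holomorphic_on strip b" and x: "0 < x1" "x1 < x2" "x2 < b" and T: "T > 0"
  shows "\<i> * (integral {-T..T} (\<lambda>y. F (Complex x2 y)) - integral {-T..T} (\<lambda>y. F (Complex x1 y)))
    = contour_integral (linepath (Complex x1 T) (Complex x2 T)) F
      - contour_integral (linepath (Complex x1 (-T)) (Complex x2 (-T))) F"
proof -
  let ?a1 = "Complex x1 (-T)" and ?a2 = "Complex x2 (-T)"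
  let ?a3 = "Complex x2 T" and ?a4 = "Complex x1 T"
  have conv: "convex (strip b)"
    unfolding strip_def Collect_conj_eq by (intro convex_Int convex_halfspace_Re_gt convex_halfspace_Re_lt)
  have in_strip: "?a1 \<in> strip b" "?a2 \<in> strip b" "?a3 \<in> strip b" "?a4 \<in> strip b"
    using x by (auto simp: strip_def)
  have seg: "closed_segment u v \<subseteq> strip b" if "u \<in> strip b" "v \<in> strip b" for u v
    using conv that by (simp add: closed_segment_subset)
  have cont: "continuous_on (closed_segment u v) F" if "u \<in> strip b" "v \<in> strip b" for u v
    using F seg[OF that] by (meson continuous_on_subset holomorphic_on_imp_continuous_on)
  have "(F has_contour_integral 0) (linepath ?a1 ?a2 +++ linepath ?a2 ?a3 +++ linepath ?a3 ?a4 +++ linepath ?a4 ?a1)"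
    using in_strip seg by (intro Cauchy_theorem_convex_simple[OF F conv]) (auto simp: path_image_join)
  then have "contour_integral (linepath ?a1 ?a2) F + contour_integral (linepath ?a2 ?a3) F
     + contour_integral (linepath ?a3 ?a4) F + contour_integral (linepath ?a4 ?a1) F = 0"
    by (rule has_chain_integral_chain_integral4)
  moreover have "contour_integral (linepath ?a3 ?a4) F = - contour_integral (linepath ?a4 ?a3) F"
    "contour_integral (linepath ?a4 ?a1) F = - contour_integral (linepath ?a1 ?a4) F"
    by (intro contour_integral_reverse_linepath cont in_strip)+
  moreover have "contour_integral (linepath ?a2 ?a3) F = \<i> * integral {-T..T} (\<lambda>y. F (Complex x2 y))"
    "contour_integral (linepath ?a1 ?a4) F = \<i> * integral {-T..T} (\<lambda>y. F (Complex x1 y))"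
    using T by (intro contour_integral_linepath_same_Re; simp)+
  ultimately show ?thesis
    by (simp add: algebra_simps)
qed

lemma integral_symmetric_interval_tendsto:
  fixes f :: "real \<Rightarrow> complex"
  assumes f: "integrable lborel f"
  shows "((\<lambda>T. integral {-T..T} f) \<longlongrightarrow> (LINT y|lborel. f y)) at_top"
proof -
  have [measurable]: "f \<in> borel_measurable borel" using f by auto
  have "((\<lambda>T. LINT y|lborel. indicator {-T..T} y *\<^sub>R f y) \<longlongrightarrow> (LINT y|lborel. f y)) at_top"
  proof (rule integral_dominated_convergence_at_top[where w = "\<lambda>y. norm (f y)"])
    show "AE y in lborel. ((\<lambda>T. indicator {-T..T} y *\<^sub>R f y) \<longlongrightarrow> f y) at_top"
    proof (intro AE_I2 tendsto_eventually)
      fix y show "\<forall>\<^sub>F T in at_top. indicator {-T..T} y *\<^sub>R f y = f y"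
        using eventually_ge_at_top[of "\<bar>y\<bar>"]
        by eventually_elim (auto split: split_indicator)
    qed
  qed (use f in \<open>auto split: split_indicator\<close>)
  moreover have "(LINT y|lborel. indicator {-T..T} y *\<^sub>R f y) = integral {-T..T} f" for T
  proof -
    have "set_integrable lborel {-T..T} f"
      using f unfolding set_integrable_def by (intro integrable_mult_indicator) auto
    from set_borel_integral_eq_integral(2)[OF this] show ?thesis
      by (simp add: set_lebesgue_integral_def)
  qed
  ultimately show ?thesis by simp
qed

lemma integrable_vertical_line:
  assumes "F holomorphic_on strip b" "0 < x" "x < b"
    "(\<integral>\<^sup>+y. ennreal (norm (F (Complex x y))) \<partial>lborel) < \<infinity>"
  shows "integrable lborel (\<lambda>y. F (Complex x y))"
proof (rule integrableI_bounded)
  have "continuous_on UNIV (F \<circ> Complex x)"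
  proof (intro continuous_on_compose)
    show "continuous_on UNIV (Complex x)"
      by (simp add: Complex_eq[abs_def]; intro continuous_intros)
    show "continuous_on (range (Complex x)) F"
      by (rule continuous_on_subset[OF holomorphic_on_imp_continuous_on[OF assms(1)]])
         (use assms in \<open>auto simp: strip_def\<close>)
  qed
  then show "(\<lambda>y. F (Complex x y)) \<in> borel_measurable lborel"
    by (simp add: borel_measurable_continuous_onI o_def)
qed (use assms in auto)

lemma open_strip: "open (strip b)"
  unfolding strip_def Collect_conj_eq by (intro open_Int open_halfspace_Re_gt open_halfspace_Re_lt)

text \<open>Cauchy's theorem on the rectangle between the heights \<open>-T\<close> and \<open>T\<close>. There is no pointwise decay
  on the horizontal sides, but by Tonelli their contributions \<open>H T\<close> and \<open>H (-T)\<close> are integrable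
  in \<open>T\<close>, whereas a nonzero difference of the two vertical integrals would keep them bounded
  below for all large \<open>T\<close>.\<close>

lemma vertical_integral_eq:
  assumes F: "F holomorphic_on strip b"
    and K: "\<And>x. 0 < x \<Longrightarrow> x < b \<Longrightarrow> (\<integral>\<^sup>+y. ennreal (norm (F (Complex x y))) \<partial>lborel) \<le> ennreal K"
    and x: "0 < x1" "x1 < x2" "x2 < b"
  shows "(LINT y|lborel. F (Complex x1 y)) = (LINT y|lborel. F (Complex x2 y))"
proof (rule ccontr)
  assume neq: "(LINT y|lborel. F (Complex x1 y)) \<noteq> (LINT y|lborel. F (Complex x2 y))"
  define G where "G z = (if z \<in> strip b then F z else 0)" for z
  have [measurable]: "G \<in> borel_measurable borel"
    unfolding G_def using F open_strip[of b]
    by (intro borel_measurable_continuous_on_if)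
       (auto intro: holomorphic_on_imp_continuous_on)
  have [measurable]: "(\<lambda>(x, y). Complex x y) \<in> borel \<Otimes>\<^sub>M borel \<rightarrow>\<^sub>M borel"
    unfolding borel_prod
    by (intro borel_measurable_continuous_onI) (simp add: Complex_eq case_prod_unfold; intro continuous_intros)
  define X where "X t = x1 + t * (x2 - x1)" for t
  have [measurable]: "X \<in> borel \<rightarrow>\<^sub>M borel" unfolding X_def by measurable
  have X: "0 < X t" "X t < b" if "0 \<le> t" "t \<le> 1" for t
  proof -
    have "t * (x2 - x1) \<le> x2 - x1" "0 \<le> t * (x2 - x1)"
      using that x by (auto intro: mult_left_le_one_le)
    then have "x1 \<le> X t" "X t \<le> x2"
      unfolding X_def by linarith+
    then show "0 < X t" "X t < b" using x by linarith+
  qed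
  define H where "H T = (\<integral>\<^sup>+t\<in>{0..1}. ennreal (norm (G (Complex (X t) T))) \<partial>lborel)" for T
  have [measurable]: "(\<lambda>w. G (Complex (X (fst w)) (s * snd w))) \<in> borel_measurable (lborel \<Otimes>\<^sub>M lborel)" for s
  proof -
    have "(\<lambda>w. G ((\<lambda>(x, y). Complex x y) (X (fst w), s * snd w))) \<in> borel_measurable (lborel \<Otimes>\<^sub>M lborel)"
      by measurable
    then show ?thesis by simp
  qed
  \<comment> \<open>by Tonelli the horizontal sides have finite total mass; \<open>s\<close> selects upper or lower sides\<close>
  have intH: "(\<integral>\<^sup>+T. H (s * T) \<partial>lborel) \<le> ennreal K" if s: "s = 1 \<or> s = -1" for s
  proof -
    have "(\<integral>\<^sup>+T. H (s * T) \<partial>lborel)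
       = (\<integral>\<^sup>+t. (\<integral>\<^sup>+T. ennreal (norm (G (Complex (X t) (s * T)))) * indicator {0..1} t \<partial>lborel) \<partial>lborel)"
      unfolding H_def
      by (rule lborel_pair.Fubini'[where f = "\<lambda>t T. ennreal (norm (G (Complex (X t) (s * T)))) * indicator {0..1} t"])
         (simp add: case_prod_unfold)
    also have "\<dots> \<le> (\<integral>\<^sup>+t. ennreal K * indicator {0..1::real} t \<partial>lborel)"
    proof (rule nn_integral_mono)
      fix t :: real
      have "(\<integral>\<^sup>+T. ennreal (norm (G (Complex (X t) (s * T)))) \<partial>lborel) \<le> ennreal K" if "0 \<le> t" "t \<le> 1"
      proof -
        have "(\<integral>\<^sup>+T. ennreal (norm (G (Complex (X t) (s * T)))) \<partial>lborel)
            = (\<integral>\<^sup>+T. ennreal (norm (G (Complex (X t) T))) \<partial>lborel)"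
          using s nn_integral_real_affine[of "\<lambda>T. ennreal (norm (G (Complex (X t) T)))" s 0] by auto
        also have "\<dots> \<le> ennreal K"
          using K[OF X[OF that]] X[OF that] by (simp add: G_def strip_def)
        finally show ?thesis .
      qed
      then show "(\<integral>\<^sup>+T. ennreal (norm (G (Complex (X t) (s * T)))) * indicator {0..1} t \<partial>lborel)
          \<le> ennreal K * indicator {0..1} t"
        by (auto split: split_indicator)
    qed
    also have "\<dots> = ennreal K" by (simp add: nn_integral_cmult_indicator)
    finally show ?thesis .
  qed
  have int: "integrable lborel (\<lambda>y. F (Complex x1 y))" "integrable lborel (\<lambda>y. F (Complex x2 y))"
    using K[of x1] K[of x2] x by (auto intro!: integrable_vertical_line[OF F] intro: le_less_trans)
  define \<delta> where "\<delta> = norm ((LINT y|lborel. F (Complex x2 y)) - (LINT y|lborel. F (Complex x1 y)))"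
  have \<delta>: "\<delta> > 0" using neq by (simp add: \<delta>_def)
  have "((\<lambda>T. norm (integral {-T..T} (\<lambda>y. F (Complex x2 y)) - integral {-T..T} (\<lambda>y. F (Complex x1 y)))) \<longlongrightarrow> \<delta>) at_top"
    unfolding \<delta>_def using int by (intro tendsto_intros integral_symmetric_interval_tendsto)
  then have "\<forall>\<^sub>F T in at_top. norm (integral {-T..T} (\<lambda>y. F (Complex x2 y)) - integral {-T..T} (\<lambda>y. F (Complex x1 y))) > \<delta> / 2"
    using \<delta> by (intro order_tendstoD) auto
  then obtain T0 where T0: "\<And>T. T \<ge> T0 \<Longrightarrow> norm (integral {-T..T} (\<lambda>y. F (Complex x2 y)) - integral {-T..T} (\<lambda>y. F (Complex x1 y))) > \<delta> / 2"
    unfolding eventually_at_top_linorder by blast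
  have hor: "ennreal (norm (contour_integral (linepath (Complex x1 T) (Complex x2 T)) F)) \<le> ennreal (x2 - x1) * H T" for T
  proof -
    have "continuous_on (closed_segment (Complex x1 T) (Complex x2 T)) F"
      by (rule continuous_on_subset[OF holomorphic_on_imp_continuous_on[OF F]])
         (use x in \<open>auto simp: strip_def closed_segment_same_Im closed_segment_eq_real_ivl\<close>)
    from norm_contour_integral_horizontal_le[OF this] x
    have "ennreal (norm (contour_integral (linepath (Complex x1 T) (Complex x2 T)) F))
       \<le> ennreal (x2 - x1) * (\<integral>\<^sup>+t\<in>{0..1}. ennreal (norm (F (Complex (X t) T))) \<partial>lborel)"
      by (simp add: X_def)
    also have "(\<integral>\<^sup>+t\<in>{0..1}. ennreal (norm (F (Complex (X t) T))) \<partial>lborel) = H T"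
      unfolding H_def using X by (intro nn_integral_cong) (auto simp: G_def strip_def split: split_indicator)
    finally show ?thesis .
  qed
  have low: "ennreal (\<delta> / 2) \<le> ennreal (x2 - x1) * (H (1 * T) + H (-1 * T))" if T: "T \<ge> max T0 1" for T
  proof -
    let ?h = "\<lambda>T. contour_integral (linepath (Complex x1 T) (Complex x2 T)) F"
    have "\<delta> / 2 \<le> norm (\<i> * (integral {-T..T} (\<lambda>y. F (Complex x2 y)) - integral {-T..T} (\<lambda>y. F (Complex x1 y))))"
      using T0[of T] T by (simp add: norm_mult)
    also have "\<dots> = norm (?h T - ?h (-T))"
      using contour_integral_rectangle[OF F x, of T] T by simp
    also have "\<dots> \<le> norm (?h T) + norm (?h (-T))"
      by (rule norm_triangle_ineq4)
    finally have "ennreal (\<delta> / 2) \<le> ennreal (norm (?h T) + norm (?h (-T)))"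
      by (rule ennreal_leI)
    also have "\<dots> \<le> ennreal (x2 - x1) * H T + ennreal (x2 - x1) * H (-T)"
      using hor[of T] hor[of "-T"] by (simp add: add_mono)
    finally show ?thesis by (simp add: distrib_left)
  qed
  have mH: "(\<lambda>T. H (s * T)) \<in> borel_measurable lborel" for s
    unfolding H_def
    by (rule lborel.borel_measurable_nn_integral_fst[where f = "\<lambda>w. ennreal (norm (G (Complex (X (snd w)) (s * fst w)))) * indicator {0..1} (snd w)", simplified])
       (use measurable_compose[OF measurable_pair_swap'[of lborel lborel], of "\<lambda>w. G (Complex (X (fst w)) (s * snd w))" borel] in \<open>auto simp: case_prod_unfold\<close>)
  have "(\<integral>\<^sup>+T. ennreal (\<delta> / 2) * indicator {max T0 1..} T \<partial>lborel)
     \<le> (\<integral>\<^sup>+T. ennreal (x2 - x1) * (H (1 * T) + H (-1 * T)) \<partial>lborel)"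
    using low by (intro nn_integral_mono) (auto split: split_indicator)
  also have "\<dots> = ennreal (x2 - x1) * ((\<integral>\<^sup>+T. H (1 * T) \<partial>lborel) + (\<integral>\<^sup>+T. H (-1 * T) \<partial>lborel))"
    by (simp only: nn_integral_cmult nn_integral_add borel_measurable_add mH)
  also have "\<dots> \<le> ennreal (x2 - x1) * (ennreal K + ennreal K)"
    by (intro mult_left_mono add_mono intH) auto
  also have "\<dots> < \<infinity>" by (simp add: ennreal_mult_less_top)
  finally have "(\<integral>\<^sup>+T. ennreal (\<delta> / 2) * indicator {max T0 1..} T \<partial>lborel) < \<infinity>" .
  moreover have "emeasure lborel {max T0 1..} = \<infinity>"
  proof (rule ccontr)
    assume "emeasure lborel {max T0 1..} \<noteq> \<infinity>"
    then obtain n where n: "emeasure lborel {max T0 1..} < of_nat n"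
      using ennreal_Ex_less_of_nat[of "emeasure lborel {max T0 1..}"] by (auto simp: less_top)
    have "of_nat n = emeasure lborel {max T0 1..max T0 1 + real n}"
      by (simp add: ennreal_of_nat_eq_real_of_nat)
    also have "\<dots> \<le> emeasure lborel {max T0 1..}"
      by (intro emeasure_mono) auto
    finally show False using n by simp
  qed
  ultimately show False
    using \<delta> by (simp add: nn_integral_cmult_indicator ennreal_mult_eq_top_iff ennreal_mult_top)
qed

section \<open>Integration against omega\<close>

lemma norm_powr_2: "norm z powr 2 = (norm z)\<^sup>2"
  by (cases "norm z = 0") auto

lemma borel_measurable_cnj [measurable (raw)]:
  "f \<in> borel_measurable M \<Longrightarrow> (\<lambda>x. cnj (f x)) \<in> borel_measurable M"
  by (rule measurable_compose[OF _ borel_measurable_continuous_onI[of cnj]]) (auto intro: continuous_intros)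

lemma closed_half_plane_measurable [measurable]: "{z::complex. Re z \<ge> 0} \<in> sets borel"
  using closed_halfspace_Re_ge by (rule borel_closed)

lemma measurable_omega_iff:
  fixes f :: "complex \<Rightarrow> 'a::real_normed_vector"
  shows "f \<in> borel_measurable omega \<longleftrightarrow> (\<lambda>z. indicator {z. Re z \<ge> 0} z *\<^sub>R f z) \<in> borel_measurable borel"
  unfolding omega_def closure_right_half_plane
  by (subst borel_measurable_restrict_space_iff) auto

lemma measurable_omega_I:
  "f \<in> borel_measurable borel \<Longrightarrow> (f :: complex \<Rightarrow> complex) \<in> borel_measurable omega"
  by (simp add: measurable_omega_iff)

lemma measurable_omega_line:
  assumes "f \<in> borel_measurable omega" "x \<ge> 0"
  shows "(\<lambda>y. f (Complex x y)) \<in> borel_measurable borel"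
proof -
  have "Complex x \<in> borel \<rightarrow>\<^sub>M omega"
    unfolding omega_def closure_right_half_plane
    by (rule measurable_restrict_space2) (use assms(2) in auto)
  from measurable_compose[OF this assms(1)] show ?thesis .
qed

lemma nn_integral_omega_lines:
  fixes f :: "complex \<Rightarrow> 'a::real_normed_vector"
  assumes "f \<in> borel_measurable omega" and [measurable]: "c \<in> borel_measurable borel"
  shows "(\<integral>\<^sup>+z. c (norm (f z)) \<partial>omega) =
    (\<Sum>n. ennreal (2 ^ n / fact n) * (\<integral>\<^sup>+y. c (norm (f (Complex (real n / 2) y))) \<partial>lborel))"
proof -
  define f0 where "f0 z = indicator {z. Re z \<ge> 0} z *\<^sub>R f z" for z
  have [measurable]: "f0 \<in> borel_measurable borel"
    using assms(1) by (simp add: measurable_omega_iff f0_def[abs_def])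
  have "(\<integral>\<^sup>+z. c (norm (f z)) \<partial>omega) = (\<integral>\<^sup>+z. c (norm (f0 z)) \<partial>omega)"
    by (intro nn_integral_cong) (simp add: space_omega f0_def)
  also have "\<dots> = (\<Sum>n. ennreal (2 ^ n / fact n) * (\<integral>\<^sup>+y. c (norm (f0 (Complex (real n / 2) y))) \<partial>lborel))"
    by (rule nn_integral_omega) measurable
  finally show ?thesis by (simp add: f0_def)
qed

lemma nn_integral_line_finite:
  fixes f :: "complex \<Rightarrow> 'a::real_normed_vector"
  assumes "f \<in> borel_measurable omega" and [measurable]: "c \<in> borel_measurable borel"
    and fin: "(\<integral>\<^sup>+z. c (norm (f z)) \<partial>omega) < \<infinity>"
  shows "(\<integral>\<^sup>+y. c (norm (f (Complex (real n / 2) y))) \<partial>lborel) < \<infinity>"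
proof -
  let ?t = "\<lambda>n. ennreal (2 ^ n / fact n) * (\<integral>\<^sup>+y. c (norm (f (Complex (real n / 2) y))) \<partial>lborel)"
  have "?t n \<le> (\<Sum>n. ?t n)"
    using sum_le_suminf[of ?t "{n}"] by simp
  also have "\<dots> < \<infinity>"
    using fin nn_integral_omega_lines[OF assms(1,2)] by simp
  finally show ?thesis
    by (auto simp: ennreal_mult_less_top)
qed

lemma finite_measure_omega_radial: "finite_measure omega_radial"
proof
  have "emeasure omega_radial (space omega_radial) = (\<Sum>n. ennreal (2 ^ n / fact n))"
    unfolding omega_radial_def
    by (simp add: emeasure_distr emeasure_density nn_integral_count_space_nat)
  also have "\<dots> = ennreal (\<Sum>n. 2 ^ n / fact n)"
    using summable_exp[of "2::real"] by (intro suminf_ennreal2) (auto simp: field_simps)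
  finally show "emeasure omega_radial (space omega_radial) \<noteq> \<infinity>" by simp
qed

text \<open>The counterpart of \<^term>\<open>nn_integral\<close> over \<^term>\<open>omega\<close> for complex integrands: Fubini over
  the product of the radial measure and Lebesgue measure.\<close>

lemma integral_omega_sums:
  fixes F :: "complex \<Rightarrow> complex"
  assumes F: "integrable omega F"
  shows "(\<lambda>n. (2 ^ n / fact n) *\<^sub>R (\<integral>y. F (Complex (real n / 2) y) \<partial>lborel)) sums (\<integral>z. F z \<partial>omega)"
proof -
  define G where "G z = indicator {z. Re z \<ge> 0} z *\<^sub>R F z" for z
  have [measurable]: "G \<in> borel_measurable borel"
    using F by (auto simp: measurable_omega_iff[symmetric] G_def[abs_def])
  have [measurable]: "(\<lambda>(x, y). Complex x y) \<in> borel \<Otimes>\<^sub>M borel \<rightarrow>\<^sub>M borel"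
    unfolding borel_prod
    by (intro borel_measurable_continuous_onI) (simp add: Complex_eq case_prod_unfold; intro continuous_intros)
  have s [measurable_cong]: "sets omega_radial = sets borel"
    by (simp add: omega_radial_def)
  interpret R: finite_measure omega_radial by (rule finite_measure_omega_radial)
  interpret pair_sigma_finite omega_radial lborel ..
  let ?D = "distr (omega_radial \<Otimes>\<^sub>M lborel) borel (\<lambda>(x, y). Complex x y)"
  have "integrable ?D G"
    using F unfolding omega_def closure_right_half_plane G_def
    by (subst (asm) integrable_restrict_space) auto
  then have iG: "integrable (omega_radial \<Otimes>\<^sub>M lborel) (\<lambda>w. G (Complex (fst w) (snd w)))"
    by (subst (asm) integrable_distr_eq) (auto simp: case_prod_unfold)
  define J where "J x = (\<integral>y. G (Complex x y) \<partial>lborel)" for x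
  have [measurable]: "J \<in> borel_measurable borel"
    unfolding J_def by measurable
  have iJ: "integrable omega_radial J"
    using integrable_fst'[OF iG] by (simp add: J_def[abs_def])
  have "(\<integral>z. F z \<partial>omega) = (\<integral>z. G z \<partial>?D)"
    unfolding omega_def closure_right_half_plane G_def by (subst integral_restrict_space) auto
  also have "\<dots> = (\<integral>w. G (Complex (fst w) (snd w)) \<partial>(omega_radial \<Otimes>\<^sub>M lborel))"
    by (subst integral_distr) (auto simp: case_prod_unfold)
  also have "\<dots> = (\<integral>x. J x \<partial>omega_radial)"
    using integral_fst'[OF iG] by (simp add: J_def)
  also have "\<dots> = (\<integral>n. (2 ^ n / fact n) *\<^sub>R J (real n / 2) \<partial>count_space UNIV)"
    unfolding omega_radial_def by (subst integral_distr) (auto simp: integral_density)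
  finally have eq: "(\<integral>z. F z \<partial>omega) = (\<integral>n. (2 ^ n / fact n) *\<^sub>R J (real n / 2) \<partial>count_space UNIV)" .
  have "integrable (count_space UNIV) (\<lambda>n. (2 ^ n / fact n) *\<^sub>R J (real n / 2))"
    using iJ unfolding omega_radial_def
    by (subst (asm) integrable_distr_eq) (auto simp: integrable_density)
  from sums_integral_count_space_nat[OF this] eq
  show ?thesis by (simp add: J_def G_def)
qed

lemma Lp2_lines_finite:
  assumes "f \<in> Lp 2 omega"
  shows "(\<integral>\<^sup>+y. ennreal ((norm (f (Complex (real n / 2) y)))\<^sup>2) \<partial>lborel) < \<infinity>"
proof (rule nn_integral_line_finite[where c = "\<lambda>t. ennreal (t\<^sup>2)"])
  show "f \<in> borel_measurable omega" "(\<integral>\<^sup>+z. ennreal ((norm (f z))\<^sup>2) \<partial>omega) < \<infinity>"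
    using assms by (auto simp: Lp_def integrable_iff_bounded norm_powr_2)
qed auto

lemma integrable_mult_cnj_Lp2:
  assumes "f \<in> Lp 2 M" "g \<in> Lp 2 M"
  shows "integrable M (\<lambda>z. f z * cnj (g z))"
proof (rule Bochner_Integration.integrable_bound)
  show "integrable M (\<lambda>z. (norm (f z))\<^sup>2 + (norm (g z))\<^sup>2)"
    using assms by (auto simp: Lp_def norm_powr_2)
  have [measurable]: "f \<in> borel_measurable M" "g \<in> borel_measurable M"
    using assms by (auto simp: Lp_def norm_powr_2)
  show "(\<lambda>z. f z * cnj (g z)) \<in> borel_measurable M" by measurable
  show "AE z in M. norm (f z * cnj (g z)) \<le> norm ((norm (f z))\<^sup>2 + (norm (g z))\<^sup>2)"
  proof (rule AE_I2)
    fix z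
    have "norm (f z) * norm (g z) \<le> (norm (f z))\<^sup>2 + (norm (g z))\<^sup>2"
      using sum_squares_bound[of "norm (f z)" "norm (g z)"]
        mult_nonneg_nonneg[OF norm_ge_zero[of "f z"] norm_ge_zero[of "g z"]] by linarith
    then show "norm (f z * cnj (g z)) \<le> norm ((norm (f z))\<^sup>2 + (norm (g z))\<^sup>2)"
      by (simp add: norm_mult)
  qed
qed

text \<open>In the interior of the strip the product is in the Hardy class of exponent \<open>1\<close>, so contour
  shifting applies. The line \<open>Re z = 0\<close> is reached from the right along the measure with density
  \<open>1 / (1 + y\<^sup>2)\<close>: relative to it the product is \<open>L\<^sup>2\<close>-bounded, because \<open>\<Phi>\<close> times \<open>1 + y\<^sup>2\<close> is bounded.\<close>

lemma vertical_integral_product_eq: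
  assumes \<Phi>: "\<Phi> holomorphic_on {z. Re z < B}"
    and bound: "\<And>x y. 0 \<le> x \<Longrightarrow> x < B \<Longrightarrow> norm (\<Phi> (Complex x y)) \<le> A / (1 + y\<^sup>2)"
    and g: "g \<in> M_omega 2"
    and x: "0 \<le> x1" "x1 < B" "0 \<le> x2" "x2 < B"
  shows "(LINT y|lborel. \<Phi> (Complex x1 y) * g (Complex x1 y))
       = (LINT y|lborel. \<Phi> (Complex x2 y) * g (Complex x2 y))"
proof -
  have B: "B > 0" using x by linarith
  define F where "F z = \<Phi> z * g z" for z
  have A0: "A \<ge> 0"
    using order_trans[OF norm_ge_zero bound[of 0 0]] B by simp
  have ghol: "g holomorphic_on right_half_plane" and gL: "g \<in> Lp 2 omega"
    and gH: "g \<in> hardy_strip 2 B"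
    and glim: "AE y in lborel. ((\<lambda>x. g (Complex x y)) \<longlongrightarrow> g (Complex 0 y)) (at_right 0)"
    using g B by (auto simp: M_omega_def)
  have [measurable]: "(\<lambda>y. g (Complex x y)) \<in> borel_measurable borel" if "x \<ge> 0" for x
    using measurable_omega_line[OF _ that] gL by (auto simp: Lp_def norm_powr_2)
  have \<Phi>_cont: "continuous_on {z. Re z < B} \<Phi>"
    using \<Phi> by (rule holomorphic_on_imp_continuous_on)
  have [measurable]: "(\<lambda>y. \<Phi> (Complex x y)) \<in> borel_measurable borel" if "x < B" for x
  proof -
    have "continuous_on UNIV (\<Phi> \<circ> Complex x)"
      by (intro continuous_on_compose continuous_on_subset[OF \<Phi>_cont])
         (use that in \<open>auto simp: Complex_eq[abs_def] intro!: continuous_intros\<close>)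
    then show ?thesis
      by (simp add: borel_measurable_continuous_onI o_def)
  qed
  have Fmeas [measurable]: "(\<lambda>y. F (Complex x y)) \<in> borel_measurable borel" if "0 \<le> x" "x < B" for x
    unfolding F_def using that by measurable
  obtain S where S: "S \<ge> 0"
    "\<And>x. 0 \<le> x \<Longrightarrow> x < B \<Longrightarrow> (\<integral>\<^sup>+y. ennreal ((norm (g (Complex x y)))\<^sup>2) \<partial>lborel) \<le> ennreal S"
  proof -
    define S1 where "S1 = (SUP x\<in>{0<..<B}. \<integral>\<^sup>+y. ennreal ((norm (g (Complex x y)))\<^sup>2) \<partial>lborel)"
    define S2 where "S2 = (\<integral>\<^sup>+y. ennreal ((norm (g (Complex 0 y)))\<^sup>2) \<partial>lborel)"
    have fin: "S1 < \<infinity>" "S2 < \<infinity>"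
      using gH Lp2_lines_finite[OF gL, of 0] by (auto simp: hardy_strip_def S1_def S2_def)
    then have "max S1 S2 < \<infinity>" by simp
    then obtain S where S: "max S1 S2 = ennreal S" "S \<ge> 0"
      by (cases "max S1 S2") auto
    have "(\<integral>\<^sup>+y. ennreal ((norm (g (Complex x y)))\<^sup>2) \<partial>lborel) \<le> max S1 S2" if "0 \<le> x" "x < B" for x
    proof (cases "x = 0")
      case False
      then show ?thesis using that
        unfolding S1_def by (intro max.coboundedI1 SUP_upper) auto
    qed (simp add: S2_def)
    then show thesis using that[of S] S by auto
  qed
  have pos: "1 + y\<^sup>2 > 0" for y :: real by (simp add: add_pos_nonneg)
  have Fbound: "norm (F (Complex x y)) \<le> A / (1 + y\<^sup>2) * norm (g (Complex x y))"
    if "0 \<le> x" "x < B" for x y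
    unfolding F_def norm_mult using bound[OF that] by (intro mult_right_mono) auto
  define W where "W = (LINT y|lborel. 1 / (1 + y\<^sup>2) :: real)"
  have nnW: "(\<integral>\<^sup>+y. ennreal (1 / (1 + y\<^sup>2)) \<partial>lborel) = ennreal W"
    unfolding W_def using pos
    by (intro nn_integral_eq_integral integrable_cauchy_density) (auto simp: less_imp_le)
  have W0: "W \<ge> 0" unfolding W_def using pos by (auto simp: less_imp_le)
  define K where "K = A * W + A * S"
  have FK: "(\<integral>\<^sup>+y. ennreal (norm (F (Complex x y))) \<partial>lborel) \<le> ennreal K" if "0 < x" "x < B" for x
  proof -
    have x: "0 \<le> x" "x < B" using that by auto
    have le: "norm (F (Complex x y)) \<le> A * (1 / (1 + y\<^sup>2)) + A * (norm (g (Complex x y)))\<^sup>2" for y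
    proof -
      define t where "t = norm (g (Complex x y))"
      define w where "w = 1 / (1 + y\<^sup>2)"
      have w: "0 \<le> w" "w \<le> 1" using pos[of y] by (auto simp: w_def)
      have "t \<le> 1 + t\<^sup>2" using self_le_power[of t 2] zero_le_power2[of t] by (cases "t \<ge> 1") (simp, linarith)
      then have "w * t \<le> w * (1 + t\<^sup>2)" using w by (intro mult_left_mono) auto
      also have "\<dots> \<le> w + 1 * t\<^sup>2" using w by (simp add: distrib_left mult_left_le_one_le)
      finally have "A * (w * t) \<le> A * (w + 1 * t\<^sup>2)" using A0 by (rule mult_left_mono)
      then show ?thesis using Fbound[OF x, of y] by (simp add: t_def w_def distrib_left)
    qed
    have "(\<integral>\<^sup>+y. ennreal (norm (F (Complex x y))) \<partial>lborel)
       \<le> (\<integral>\<^sup>+y. ennreal A * ennreal (1 / (1 + y\<^sup>2)) + ennreal A * ennreal ((norm (g (Complex x y)))\<^sup>2) \<partial>lborel)"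
      using le A0 pos by (intro nn_integral_mono) (simp add: ennreal_leI less_imp_le flip: ennreal_mult ennreal_plus)
    also have "\<dots> = ennreal A * ennreal W + ennreal A * (\<integral>\<^sup>+y. ennreal ((norm (g (Complex x y)))\<^sup>2) \<partial>lborel)"
      using x by (simp add: nn_integral_add nn_integral_cmult nnW)
    also have "\<dots> \<le> ennreal A * ennreal W + ennreal A * ennreal S"
      using S(2)[OF x] by (intro add_left_mono mult_left_mono) auto
    also have "\<dots> = ennreal K"
      using A0 W0 S(1) by (simp add: K_def ennreal_mult ennreal_plus)
    finally show ?thesis .
  qed
  have Fhol: "F holomorphic_on strip B"
    unfolding F_def[abs_def]
    by (intro holomorphic_on_mult holomorphic_on_subset[OF \<Phi>] holomorphic_on_subset[OF ghol])
       (auto simp: strip_def right_half_plane_def)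
  have interior: "(LINT y|lborel. F (Complex a y)) = (LINT y|lborel. F (Complex b y))"
    if "0 < a" "a < B" "0 < b" "b < B" for a b
  proof (cases a b rule: linorder_cases)
    case less
    then show ?thesis using that by (intro vertical_integral_eq[OF Fhol FK])
  next
    case greater
    then show ?thesis using that by (intro vertical_integral_eq[OF Fhol FK, symmetric])
  qed simp
  have boundary: "(LINT y|lborel. F (Complex 0 y)) = (LINT y|lborel. F (Complex a y))" if a: "0 < a" "a < B" for a
  proof -
    define \<mu> where "\<mu> = density lborel (\<lambda>y. ennreal (1 / (1 + y\<^sup>2)))"
    have [measurable_cong]: "sets \<mu> = sets borel" by (simp add: \<mu>_def)
    interpret \<mu>: finite_measure \<mu>
      by standard (simp add: \<mu>_def emeasure_density nnW)
    define u where "u x y = (1 + y\<^sup>2) *\<^sub>R F (Complex x y)" for x y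
    have um: "u x \<in> borel_measurable borel" if "0 \<le> x" "x < B" for x
      unfolding u_def using that by measurable
    have int_u: "(LINT y|\<mu>. u x y) = (LINT y|lborel. F (Complex x y))" if "0 \<le> x" "x < B" for x
    proof -
      have "(LINT y|\<mu>. u x y) = (LINT y|lborel. (1 / (1 + y\<^sup>2)) *\<^sub>R u x y)"
        unfolding \<mu>_def using um[OF that] pos by (intro integral_density) (auto simp: less_imp_le)
      also have "\<dots> = (LINT y|lborel. F (Complex x y))"
        unfolding u_def using pos by (intro Bochner_Integration.integral_cong) (auto simp: less_imp_neq[symmetric])
      finally show ?thesis .
    qed
    have u2: "(\<integral>\<^sup>+y. ennreal ((norm (u x y))\<^sup>2) \<partial>\<mu>) \<le> ennreal (A\<^sup>2 * S)" if x: "0 \<le> x" "x < B" for x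
    proof -
      have "(\<integral>\<^sup>+y. ennreal ((norm (u x y))\<^sup>2) \<partial>\<mu>)
         = (\<integral>\<^sup>+y. ennreal (1 / (1 + y\<^sup>2)) * ennreal ((norm (u x y))\<^sup>2) \<partial>lborel)"
        unfolding \<mu>_def using um[OF x] by (intro nn_integral_density) auto
      also have "\<dots> \<le> (\<integral>\<^sup>+y. ennreal (A\<^sup>2) * ennreal ((norm (g (Complex x y)))\<^sup>2) \<partial>lborel)"
      proof (rule nn_integral_mono)
        fix y
        have "norm (u x y) \<le> (1 + y\<^sup>2) * (A / (1 + y\<^sup>2) * norm (g (Complex x y)))"
          unfolding u_def norm_scaleR using pos[of y] Fbound[OF x, of y] by (intro mult_mono) auto
        also have "\<dots> = A * norm (g (Complex x y))"
          using pos[of y] by simp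
        finally have "(norm (u x y))\<^sup>2 \<le> (A * norm (g (Complex x y)))\<^sup>2"
          by (intro power_mono) auto
        moreover have "1 / (1 + y\<^sup>2) \<le> 1" using pos[of y] by simp
        ultimately have "1 / (1 + y\<^sup>2) * (norm (u x y))\<^sup>2 \<le> 1 * (A * norm (g (Complex x y)))\<^sup>2"
          using pos[of y] by (intro mult_mono) auto
        then show "ennreal (1 / (1 + y\<^sup>2)) * ennreal ((norm (u x y))\<^sup>2) \<le> ennreal (A\<^sup>2) * ennreal ((norm (g (Complex x y)))\<^sup>2)"
          using pos[of y] by (simp add: ennreal_leI power_mult_distrib flip: ennreal_mult)
      qed
      also have "\<dots> = ennreal (A\<^sup>2) * (\<integral>\<^sup>+y. ennreal ((norm (g (Complex x y)))\<^sup>2) \<partial>lborel)"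
        using x by (intro nn_integral_cmult) measurable
      also have "\<dots> \<le> ennreal (A\<^sup>2) * ennreal S"
        using S(2)[OF x] by (intro mult_left_mono) auto
      finally show ?thesis using S(1) by (simp add: ennreal_mult)
    qed
    define \<epsilon> where "\<epsilon> n = B / real (n + 2)" for n
    have \<epsilon>: "0 < \<epsilon> n" "\<epsilon> n < B" for n
      using B by (auto simp: \<epsilon>_def field_simps intro: add_pos_nonneg)
    have "\<epsilon> \<longlonglongrightarrow> 0"
      unfolding \<epsilon>_def by (rule LIMSEQ_ignore_initial_segment[OF lim_const_over_n])
    then have \<epsilon>_lim: "filterlim \<epsilon> (at_right 0) sequentially"
      using \<epsilon>(1) by (auto simp: filterlim_at intro!: always_eventually less_imp_neq[symmetric])
    have "(\<lambda>n. LINT y|\<mu>. u (\<epsilon> n) y) \<longlonglongrightarrow> (LINT y|\<mu>. u 0 y)"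
    proof (rule \<mu>.integral_tendsto_of_L2_bounded)
      have "AE y in lborel. (\<lambda>n. u (\<epsilon> n) y) \<longlonglongrightarrow> u 0 y"
        using glim
      proof eventually_elim
        case (elim y)
        have "(\<lambda>n. g (Complex (\<epsilon> n) y)) \<longlonglongrightarrow> g (Complex 0 y)"
          using filterlim_compose[OF elim \<epsilon>_lim] .
        moreover have "(\<lambda>n. \<Phi> (Complex (\<epsilon> n) y)) \<longlonglongrightarrow> \<Phi> (Complex 0 y)"
          by (rule continuous_on_tendsto_compose[OF \<Phi>_cont])
             (use \<epsilon> B \<open>\<epsilon> \<longlonglongrightarrow> 0\<close> in \<open>auto simp: Complex_eq intro!: tendsto_eq_intros\<close>)
        ultimately show ?case
          unfolding u_def F_def by (intro tendsto_intros)
      qed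
      then show "AE y in \<mu>. (\<lambda>n. u (\<epsilon> n) y) \<longlonglongrightarrow> u 0 y"
        unfolding \<mu>_def by (subst AE_density) auto
    qed (use um u2 \<epsilon> B in \<open>auto simp: less_imp_le\<close>)
    moreover have "(LINT y|\<mu>. u (\<epsilon> n) y) = (LINT y|lborel. F (Complex a y))" for n
      using int_u[of "\<epsilon> n"] interior[of "\<epsilon> n" a] \<epsilon>[of n] a by simp
    ultimately show ?thesis
      using int_u[of 0] B LIMSEQ_unique[OF tendsto_const] by force
  qed
  have half: "0 < B / 2" "B / 2 < B" using B by auto
  have "(LINT y|lborel. F (Complex x y)) = (LINT y|lborel. F (Complex (B / 2) y))" if "0 \<le> x" "x < B" for x
  proof (cases "x = 0")
    case False
    then show ?thesis using that half by (intro interior) auto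
  qed (simp add: boundary[OF half])
  from this[OF x(1,2)] this[OF x(3,4)] show ?thesis
    unfolding F_def by simp
qed

section \<open>Test functions built from the Gamma function\<close>

text \<open>These are the projections of the functions \<open>gamma_spike k\<close>. The base \<open>3\<close> could be any number
  larger than \<open>2\<close>; with \<open>3\<close> the sum in \<open>Gamma_binomial_series\<close> is exactly \<open>\<Gamma>(s)\<close>.\<close>

definition gamma_shift :: "nat \<Rightarrow> complex \<Rightarrow> complex" where
  "gamma_shift k z = Gamma (z + of_nat k + 1) * 3 powr - (z + of_nat k + 1)"

text \<open>A function living on the single line \<open>Re z = k\<close>. The constant is the reciprocal of the
  weight of this line in \<^term>\<open>omega\<close>, where it is the line of index \<open>2k\<close>.\<close>

definition gamma_spike :: "nat \<Rightarrow> complex \<Rightarrow> complex" where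
  "gamma_spike k z = (if Re z = real k
     then of_real (fact (2 * k) / 2 ^ (2 * k)) * Gamma (Complex 1 (Im z)) else 0)"

lemma norm_gamma_shift_le:
  assumes "x + real k \<ge> -1/2"
  shows "norm (gamma_shift k (Complex x y)) \<le> 2 * Gamma (x + real k + 3) * 3 powr - (x + real k + 1) / (1 + y\<^sup>2)"
proof -
  let ?s = "Complex (x + real k + 1) y"
  have s: "Complex x y + of_nat k + 1 = ?s"
    by (simp add: complex_eq_iff)
  have "norm (gamma_shift k (Complex x y)) = norm (Gamma ?s) * 3 powr - (x + real k + 1)"
    unfolding gamma_shift_def s norm_mult by (subst norm_powr_real_powr) auto
  also have "\<dots> \<le> (2 * Gamma (x + real k + 1 + 2) / (1 + y\<^sup>2)) * 3 powr - (x + real k + 1)"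
    using assms by (intro mult_right_mono norm_Gamma_decay) auto
  finally show ?thesis by (simp add: add.assoc)
qed

lemma holomorphic_gamma_shift: "gamma_shift k holomorphic_on {z. Re z > - real k - 1}"
  unfolding gamma_shift_def
  by (intro holomorphic_intros) (auto elim!: nonpos_Ints_cases simp: complex_eq_iff)

text \<open>The range of \<open>x\<close> reaches to the left of the half-plane, because contours will be shifted to
  \<open>Re z = m - k\<close>, which may be as small as \<open>-k\<close>. The pole of \<open>gamma_shift k\<close> nearest to it is
  at \<open>-k - 1\<close>.\<close>

lemma gamma_shift_strip_bound:
  obtains A where "\<And>x y. - real k - 1/2 \<le> x \<Longrightarrow> x \<le> X \<Longrightarrow> norm (gamma_shift k (Complex x y)) \<le> A / (1 + y\<^sup>2)"
proof -
  let ?f = "\<lambda>x::real. 2 * Gamma (x + real k + 3) * 3 powr - (x + real k + 1)"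
  have "continuous_on {- real k - 1/2..X} ?f"
    by (intro continuous_intros continuous_on_compose2[OF continuous_on_Gamma[of "{0<..}"]])
       (auto elim!: nonpos_Ints_cases)
  then have "bounded (?f ` {- real k - 1/2..X})"
    by (intro compact_imp_bounded compact_continuous_image) auto
  then obtain A where A: "\<And>x. x \<in> {- real k - 1/2..X} \<Longrightarrow> norm (?f x) \<le> A"
    unfolding bounded_iff by blast
  show thesis
  proof (rule that)
    fix x y assume x: "- real k - 1/2 \<le> x" "x \<le> X"
    have "norm (gamma_shift k (Complex x y)) \<le> ?f x / (1 + y\<^sup>2)"
      using x by (intro norm_gamma_shift_le) auto
    also have "\<dots> \<le> A / (1 + y\<^sup>2)"
      using A[of x] x by (intro divide_right_mono) (auto simp: add_nonneg_nonneg)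
    finally show "norm (gamma_shift k (Complex x y)) \<le> A / (1 + y\<^sup>2)" .
  qed
qed

lemma Gamma_line_continuous: "continuous_on UNIV (\<lambda>y. Gamma (Complex 1 y))"
proof -
  have "continuous_on {z. Re z > 0} (Gamma :: complex \<Rightarrow> complex)"
    by (intro holomorphic_on_imp_continuous_on holomorphic_Gamma) (auto elim!: nonpos_Ints_cases)
  moreover have "continuous_on UNIV (Complex 1)"
    by (simp add: Complex_eq[abs_def]; intro continuous_intros)
  ultimately show ?thesis
    by (rule continuous_on_compose2) auto
qed

lemma gamma_shift_measurable_omega: "gamma_shift k \<in> borel_measurable omega"
  unfolding measurable_omega_iff
  by (rule borel_measurable_continuous_on_indicator)
     (auto intro: continuous_on_subset[OF holomorphic_on_imp_continuous_on[OF holomorphic_gamma_shift[of k]]])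

lemma nn_integral_cauchy_square_le:
  assumes "\<And>y. norm (f y) \<le> A / (1 + y\<^sup>2)"
  shows "(\<integral>\<^sup>+y. ennreal ((norm (f y))\<^sup>2) \<partial>lborel) \<le> ennreal (A\<^sup>2 * (LINT y|lborel. 1 / (1 + y\<^sup>2)))"
proof -
  have pos: "1 + y\<^sup>2 > 0" for y :: real by (simp add: add_pos_nonneg)
  have "(\<integral>\<^sup>+y. ennreal ((norm (f y))\<^sup>2) \<partial>lborel) \<le> (\<integral>\<^sup>+y. ennreal (A\<^sup>2 * (1 / (1 + y\<^sup>2))) \<partial>lborel)"
  proof (intro nn_integral_mono ennreal_leI)
    fix y :: real
    have "(norm (f y))\<^sup>2 \<le> (A / (1 + y\<^sup>2))\<^sup>2"
      using assms by (intro power_mono) auto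
    also have "\<dots> = A\<^sup>2 * (1 / (1 + y\<^sup>2) * (1 / (1 + y\<^sup>2)))"
      by (simp add: power2_eq_square)
    also have "\<dots> \<le> A\<^sup>2 * (1 / (1 + y\<^sup>2) * 1)"
      using pos[of y] by (intro mult_left_mono) auto
    finally show "(norm (f y))\<^sup>2 \<le> A\<^sup>2 * (1 / (1 + y\<^sup>2))" by simp
  qed
  also have "\<dots> = ennreal (LINT y|lborel. A\<^sup>2 * (1 / (1 + y\<^sup>2)))"
    using pos by (intro nn_integral_eq_integral integrable_mult_right integrable_cauchy_density) (auto simp: less_imp_le)
  finally show ?thesis by (simp only: integral_mult_right_zero)
qed

text \<open>On the line \<open>Re z = n/2\<close> the square of \<open>gamma_shift k\<close> integrates to at most a constant times
  \<open>\<Gamma>(n + 2k + 5) / 3\<^sup>n\<close>,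
  which against the weight \<open>2\<^sup>n / n!\<close> leaves a polynomial times \<open>(2/3)\<^sup>n\<close>.\<close>

lemma gamma_shift_Lp2: "gamma_shift k \<in> Lp 2 omega"
proof -
  define W where "W = (LINT y|lborel. 1 / (1 + y\<^sup>2) :: real)"
  have pos: "1 + y\<^sup>2 > 0" for y :: real by (simp add: add_pos_nonneg)
  have W0: "W \<ge> 0" unfolding W_def using pos by (auto simp: less_imp_le)
  let ?c = "\<lambda>n. 2 ^ n / fact n * (Gamma (2 * real k + 5 + real n) * (1/3) ^ n)"
  have "(\<integral>\<^sup>+z. ennreal ((norm (gamma_shift k z))\<^sup>2) \<partial>omega)
     = (\<Sum>n. ennreal (2 ^ n / fact n) * (\<integral>\<^sup>+y. ennreal ((norm (gamma_shift k (Complex (real n / 2) y)))\<^sup>2) \<partial>lborel))"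
    by (rule nn_integral_omega_lines[where c = "\<lambda>t. ennreal (t\<^sup>2)"])
       (auto simp: gamma_shift_measurable_omega)
  also have "\<dots> \<le> (\<Sum>n. ennreal (?c n * (4 * W)))"
  proof (intro suminf_le allI)
    fix n
    let ?x = "real n / 2"
    let ?A = "2 * Gamma (?x + real k + 3) * 3 powr - (?x + real k + 1)"
    have "(\<integral>\<^sup>+y. ennreal ((norm (gamma_shift k (Complex ?x y)))\<^sup>2) \<partial>lborel) \<le> ennreal (?A\<^sup>2 * W)"
      unfolding W_def by (intro nn_integral_cauchy_square_le norm_gamma_shift_le) auto
    also have "?A\<^sup>2 \<le> 4 * (Gamma (2 * real k + 5 + real n) * (1/3) ^ n)"
    proof -
      have "(Gamma (?x + real k + 3))\<^sup>2 \<le> Gamma (2 * (?x + real k + 3) - 1)"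
        by (intro Gamma_real_square_le) auto
      also have "2 * (?x + real k + 3) - 1 = 2 * real k + 5 + real n" by simp
      finally have 1: "(Gamma (?x + real k + 3))\<^sup>2 \<le> Gamma (2 * real k + 5 + real n)" .
      have "(3 powr - (?x + real k + 1))\<^sup>2 = 3 powr - (real n + 2 * real k + 2)"
        unfolding power2_eq_square powr_add[symmetric] by (rule arg_cong[where f = "\<lambda>t. 3 powr t"]) simp
      also have "\<dots> \<le> 3 powr - real n"
        by (intro powr_mono) auto
      also have "\<dots> = (1/3) ^ n"
        by (simp add: powr_minus powr_realpow power_divide inverse_eq_divide)
      finally have 2: "(3 powr - (?x + real k + 1))\<^sup>2 \<le> (1/3 :: real) ^ n" .
      have "?A\<^sup>2 = 4 * ((Gamma (?x + real k + 3))\<^sup>2 * (3 powr - (?x + real k + 1))\<^sup>2)"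
        by (simp add: power_mult_distrib)
      also have "\<dots> \<le> 4 * (Gamma (2 * real k + 5 + real n) * (1/3) ^ n)"
        using 1 2 by (intro mult_left_mono mult_mono) (auto intro!: less_imp_le[OF Gamma_real_pos])
      finally show ?thesis .
    qed
    then have "ennreal (?A\<^sup>2 * W) \<le> ennreal (4 * (Gamma (2 * real k + 5 + real n) * (1/3) ^ n) * W)"
      using W0 by (intro ennreal_leI mult_right_mono)
    finally have "ennreal (2 ^ n / fact n) * (\<integral>\<^sup>+y. ennreal ((norm (gamma_shift k (Complex ?x y)))\<^sup>2) \<partial>lborel)
       \<le> ennreal (2 ^ n / fact n) * ennreal (4 * (Gamma (2 * real k + 5 + real n) * (1/3) ^ n) * W)"
      by (intro mult_left_mono) auto
    also have "\<dots> = ennreal (?c n * (4 * W))"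
      using W0 by (simp add: mult_ac flip: ennreal_mult')
    finally show "ennreal (2 ^ n / fact n) * (\<integral>\<^sup>+y. ennreal ((norm (gamma_shift k (Complex ?x y)))\<^sup>2) \<partial>lborel)
       \<le> ennreal (?c n * (4 * W))" .
  qed auto
  also have "\<dots> = ennreal (\<Sum>n. ?c n * (4 * W))"
  proof (rule suminf_ennreal2)
    show "summable (\<lambda>n. ?c n * (4 * W))"
      by (intro summable_mult2 summable_Gamma_series) auto
  qed (use W0 in \<open>auto intro!: mult_nonneg_nonneg less_imp_le[OF Gamma_real_pos]\<close>)
  also have "\<dots> < \<infinity>" by simp
  finally have "integrable omega (\<lambda>z. (norm (gamma_shift k z))\<^sup>2)"
    using gamma_shift_measurable_omega by (intro integrableI_bounded) auto
  then show ?thesis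
    using gamma_shift_measurable_omega by (simp add: Lp_def norm_powr_2)
qed

lemma gamma_shift_in_M_omega: "gamma_shift k \<in> M_omega 2"
proof -
  have "gamma_shift k \<in> hardy_strip 2 b" for b
  proof -
    obtain A where A: "\<And>x y. - real k - 1/2 \<le> x \<Longrightarrow> x \<le> b \<Longrightarrow> norm (gamma_shift k (Complex x y)) \<le> A / (1 + y\<^sup>2)"
      using gamma_shift_strip_bound[of k b] by blast
    have "(SUP x\<in>{0<..<b}. \<integral>\<^sup>+y. ennreal ((norm (gamma_shift k (Complex x y)))\<^sup>2) \<partial>lborel)
       \<le> ennreal (A\<^sup>2 * (LINT y|lborel. 1 / (1 + y\<^sup>2)))"
      by (intro SUP_least nn_integral_cauchy_square_le A) auto
    also have "\<dots> < \<infinity>" by simp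
    finally show ?thesis
      by (auto simp: hardy_strip_def strip_def norm_powr_2 intro: holomorphic_on_subset[OF holomorphic_gamma_shift])
  qed
  moreover have "((\<lambda>x. gamma_shift k (Complex x y)) \<longlongrightarrow> gamma_shift k (Complex 0 y)) (at_right 0)" for y
  proof -
    have "isCont (gamma_shift k) (Complex 0 y)"
      using holomorphic_on_imp_continuous_on[OF holomorphic_gamma_shift[of k]]
      by (rule continuous_on_interior) (simp add: interior_open open_halfspace_Re_gt)
    moreover have "((\<lambda>x. Complex x y) \<longlongrightarrow> Complex 0 y) (at_right 0)"
      by (simp add: Complex_eq) (auto intro!: tendsto_eq_intros)
    ultimately show ?thesis by (rule isCont_tendsto_compose)
  qed
  ultimately show ?thesis
    unfolding M_omega_def using gamma_shift_Lp2
    by (auto simp: right_half_plane_def intro: holomorphic_on_subset[OF holomorphic_gamma_shift])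
qed

text \<open>On \<open>Re w = m/2\<close> one has \<open>cnj w = m - w\<close>, so up to conjugation the integrand is the restriction of
  the holomorphic function \<open>gamma_shift k (m - w) g(w)\<close>. Shifting \<open>w\<close> to \<open>Re w = k\<close> brings all
  lines of \<^term>\<open>omega\<close> to the same values of \<open>g\<close>.\<close>

lemma integral_gamma_shift_line:
  assumes g: "g \<in> M_omega 2"
  shows "(LINT y|lborel. gamma_shift k (Complex (real m / 2) y) * cnj (g (Complex (real m / 2) y)))
       = (LINT y|lborel. gamma_shift k (Complex (real m - real k) y) * cnj (g (Complex (real k) y)))"
proof -
  define \<Phi> where "\<Phi> z = gamma_shift k (of_nat m - z)" for z
  \<comment> \<open>to the right of both lines and to the left of the poles of \<open>\<Phi>\<close>, the first of which is at \<open>m + k + 1\<close>\<close>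
  define B where "B = real m + real k + 1/2"
  obtain A where A: "\<And>x y. - real k - 1/2 \<le> x \<Longrightarrow> x \<le> real m \<Longrightarrow> norm (gamma_shift k (Complex x y)) \<le> A / (1 + y\<^sup>2)"
    using gamma_shift_strip_bound[of k "real m"] by blast
  have \<Phi>_C: "\<Phi> (Complex x y) = gamma_shift k (Complex (real m - x) (-y))" for x y
    unfolding \<Phi>_def by (rule arg_cong[where f = "gamma_shift k"]) (simp add: complex_eq_iff)
  have "\<Phi> holomorphic_on {z. Re z < B}"
    unfolding \<Phi>_def[abs_def]
    by (rule holomorphic_on_compose_gen[OF _ holomorphic_gamma_shift[of k], unfolded o_def])
       (auto intro!: holomorphic_intros simp: B_def)
  moreover have "norm (\<Phi> (Complex x y)) \<le> A / (1 + y\<^sup>2)" if "0 \<le> x" "x < B" for x y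
    using A[of "real m - x" "-y"] that by (simp add: \<Phi>_C B_def)
  ultimately have eq: "(LINT y|lborel. \<Phi> (Complex (real m / 2) y) * g (Complex (real m / 2) y))
       = (LINT y|lborel. \<Phi> (Complex (real k) y) * g (Complex (real k) y))"
    by (rule vertical_integral_product_eq[OF _ _ g]) (auto simp: B_def)
  have cnj: "cnj (\<Phi> (Complex x y) * g (Complex x y)) = gamma_shift k (Complex (real m - x) y) * cnj (g (Complex x y))" for x y
  proof -
    have "cnj ((3::complex) powr w) = 3 powr cnj w" for w
      using Ln_of_real[of 3] by (simp add: powr_def exp_cnj)
    then have "cnj (gamma_shift k z) = gamma_shift k (cnj z)" for z
      by (simp add: gamma_shift_def cnj_Gamma)
    then show ?thesis by (simp add: \<Phi>_C complex_cnj)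
  qed
  from arg_cong[OF eq, of cnj] show ?thesis
    unfolding Bochner_Integration.integral_cnj[symmetric] cnj by simp
qed

text \<open>After the contour shift the lines differ only by their weights and by the shift
  \<open>gamma_shift k (m - k + iy) = \<Gamma>(m + 1 + iy)\<close> over \<open>3\<close> to the same argument, and these sum to
  \<open>\<Gamma>(1 + iy)\<close>.\<close>

lemma L2_inner_gamma_shift:
  assumes g: "g \<in> M_omega 2"
  shows "L2_inner omega (gamma_shift k) g = (LINT y|lborel. Gamma (Complex 1 y) * cnj (g (Complex (real k) y)))"
proof -
  have gL: "g \<in> Lp 2 omega" using g by (simp add: M_omega_def)
  have [measurable]: "(\<lambda>y. g (Complex (real k) y)) \<in> borel_measurable borel"
    using gL by (intro measurable_omega_line) (auto simp: Lp_def)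
  define u where "u m y = (2 ^ m / fact m) *\<^sub>R (gamma_shift k (Complex (real m - real k) y) * cnj (g (Complex (real k) y)))" for m y
  have "(\<lambda>m. (2 ^ m / fact m) *\<^sub>R (LINT y|lborel. gamma_shift k (Complex (real m / 2) y) * cnj (g (Complex (real m / 2) y))))
      sums L2_inner omega (gamma_shift k) g"
    unfolding L2_inner_def by (rule integral_omega_sums[OF integrable_mult_cnj_Lp2[OF gamma_shift_Lp2 gL]])
  then have 1: "(\<lambda>m. LINT y|lborel. u m y) sums L2_inner omega (gamma_shift k) g"
    by (simp add: u_def integral_gamma_shift_line[OF g])
  \<comment> \<open>the domination \<open>c m * D y\<close> allows the sum over the lines and the integral to be interchanged\<close>
  define D where "D y = norm (g (Complex (real k) y)) / (1 + y\<^sup>2)" for y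
  define c where "c m = 2 * (2 ^ m / fact m * (Gamma (3 + real m) * (1/3) ^ m))" for m
  have pos: "1 + y\<^sup>2 > 0" for y :: real by (simp add: add_pos_nonneg)
  have sc: "summable c"
    unfolding c_def by (intro summable_mult summable_Gamma_series) auto
  have c0: "c m \<ge> 0" for m unfolding c_def by (auto intro!: mult_nonneg_nonneg less_imp_le[OF Gamma_real_pos])
  have D0: "D y \<ge> 0" for y using pos[of y] by (simp add: D_def)
  have ub: "norm (u m y) \<le> c m * D y" for m y
  proof -
    have "norm (gamma_shift k (Complex (real m - real k) y)) \<le> 2 * Gamma (real m + 3) * 3 powr - (real m + 1) / (1 + y\<^sup>2)"
      using norm_gamma_shift_le[of "real m - real k" k y] by simp
    also have "\<dots> \<le> 2 * Gamma (real m + 3) * (1/3) ^ m / (1 + y\<^sup>2)"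
    proof (intro divide_right_mono mult_left_mono)
      have "3 powr - (real m + 1) \<le> 3 powr - real m" by (intro powr_mono) auto
      also have "\<dots> = (1/3) ^ m"
        by (simp add: powr_minus powr_realpow power_divide inverse_eq_divide)
      finally show "3 powr - (real m + 1) \<le> (1/3 :: real) ^ m" .
    qed (use pos[of y] in \<open>auto intro!: mult_nonneg_nonneg less_imp_le[OF Gamma_real_pos]\<close>)
    finally have "norm (u m y) \<le> 2 ^ m / fact m * ((2 * Gamma (real m + 3) * (1/3) ^ m / (1 + y\<^sup>2)) * norm (g (Complex (real k) y)))"
      unfolding u_def norm_scaleR norm_mult complex_mod_cnj
      by (subst abs_of_nonneg) (auto simp del: times_divide_eq_left times_divide_eq_right intro!: mult_left_mono mult_right_mono)
    then show ?thesis by (simp add: c_def D_def mult_ac add_ac)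
  qed
  have iD: "integrable lborel D"
  proof (rule Bochner_Integration.integrable_bound)
    show "integrable lborel (\<lambda>y. 1 / (1 + y\<^sup>2) + (norm (g (Complex (real k) y)))\<^sup>2)"
      using Lp2_lines_finite[OF gL, of "2 * k"]
      by (intro Bochner_Integration.integrable_add integrable_cauchy_density integrableI_bounded) auto
    show "D \<in> borel_measurable lborel" unfolding D_def by measurable
    show "AE y in lborel. norm (D y) \<le> norm (1 / (1 + y\<^sup>2) + (norm (g (Complex (real k) y)))\<^sup>2)"
    proof (rule AE_I2)
      fix y
      define t where "t = norm (g (Complex (real k) y))"
      define w where "w = 1 / (1 + y\<^sup>2)"
      have w: "0 \<le> w" "w \<le> 1" using pos[of y] by (auto simp: w_def)
      have "t \<le> 1 + t\<^sup>2" using self_le_power[of t 2] zero_le_power2[of t] by (cases "t \<ge> 1") (simp, linarith)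
      then have "w * t \<le> w * (1 + t\<^sup>2)" using w by (intro mult_left_mono) auto
      also have "\<dots> \<le> w + t\<^sup>2" using w by (simp add: distrib_left mult_left_le_one_le)
      finally have "D y \<le> w + t\<^sup>2" by (simp add: D_def t_def w_def)
      then show "norm (D y) \<le> norm (1 / (1 + y\<^sup>2) + (norm (g (Complex (real k) y)))\<^sup>2)"
        using D0[of y] w by (simp add: t_def w_def)
    qed
  qed
  have shiftm [measurable]: "(\<lambda>y. gamma_shift k (Complex (real m - real k) y)) \<in> borel_measurable borel" for m
  proof -
    have "continuous_on UNIV (gamma_shift k \<circ> Complex (real m - real k))"
      by (intro continuous_on_compose continuous_on_subset[OF holomorphic_on_imp_continuous_on[OF holomorphic_gamma_shift[of k]]])
         (auto simp: Complex_eq[abs_def] intro!: continuous_intros)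
    then show ?thesis by (simp add: borel_measurable_continuous_onI o_def)
  qed
  have [measurable]: "u m \<in> borel_measurable borel" for m
    unfolding u_def by measurable
  have iu: "integrable lborel (u m)" for m
    by (rule Bochner_Integration.integrable_bound[OF integrable_mult_right[OF iD, of "c m"]])
       (use ub c0 D0 in auto)
  have "(\<lambda>m. LINT y|lborel. u m y) sums (LINT y|lborel. (\<Sum>m. u m y))"
  proof (rule sums_integral[OF iu])
    have "summable (\<lambda>m. norm (u m y))" for y
      by (rule summable_comparison_test'[OF summable_mult2[OF sc, of "D y"]]) (use ub in auto)
    then show "AE y in lborel. summable (\<lambda>m. norm (u m y))" by simp
    have "norm (LINT y|lborel. norm (u m y)) \<le> c m * (LINT y|lborel. D y)" for m
    proof -
      have "(LINT y|lborel. norm (u m y)) \<le> (LINT y|lborel. c m * D y)"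
        using ub by (intro integral_mono integrable_norm iu integrable_mult_right iD) auto
      then show ?thesis by simp
    qed
    then show "summable (\<lambda>m. LINT y|lborel. norm (u m y))"
      by (intro summable_comparison_test'[OF summable_mult2[OF sc, of "LINT y|lborel. D y"]]) auto
  qed
  moreover have "(\<Sum>m. u m y) = Gamma (Complex 1 y) * cnj (g (Complex (real k) y))" for y
  proof -
    let ?s = "Complex 1 y"
    have "gamma_shift k (Complex (real m - real k) y) = Gamma (?s + of_nat m) * 3 powr - (?s + of_nat m)" for m
    proof -
      have "Complex (real m - real k) y + of_nat k + 1 = ?s + of_nat m" by (simp add: complex_eq_iff)
      then show ?thesis by (simp only: gamma_shift_def)
    qed
    moreover have "(\<lambda>m. 2 ^ m / fact m * (Gamma (?s + of_nat m) * 3 powr - (?s + of_nat m)) * cnj (g (Complex (real k) y)))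
       sums (Gamma ?s * cnj (g (Complex (real k) y)))"
      by (intro sums_mult2 Gamma_binomial_series) simp
    ultimately have "(\<lambda>m. u m y) sums (Gamma ?s * cnj (g (Complex (real k) y)))"
      by (simp add: u_def scaleR_conv_of_real mult.assoc)
    then show ?thesis by (rule sums_unique[symmetric])
  qed
  ultimately show ?thesis using sums_unique2[OF 1] by simp
qed

section \<open>The projection of a spike\<close>

lemma gamma_spike_measurable [measurable]: "gamma_spike k \<in> borel_measurable borel"
proof -
  have [measurable]: "(\<lambda>y. Gamma (Complex 1 y)) \<in> borel_measurable borel"
    by (intro borel_measurable_continuous_onI Gamma_line_continuous)
  show ?thesis unfolding gamma_spike_def by measurable
qed

lemma nn_integral_gamma_spike:
  assumes q: "q > 0"
  shows "(\<integral>\<^sup>+z. ennreal (norm (gamma_spike k z) powr q) \<partial>omega)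
    = ennreal ((fact (2 * k) / 2 ^ (2 * k)) powr (q - 1)) * (\<integral>\<^sup>+y. ennreal (norm (Gamma (Complex 1 y)) powr q) \<partial>lborel)"
proof -
  define a :: real where "a = fact (2 * k) / 2 ^ (2 * k)"
  have a: "a > 0" by (simp add: a_def)
  have [measurable]: "(\<lambda>y. Gamma (Complex 1 y)) \<in> borel_measurable borel"
    by (intro borel_measurable_continuous_onI Gamma_line_continuous)
  have "(\<integral>\<^sup>+z. ennreal (norm (gamma_spike k z) powr q) \<partial>omega)
     = (\<Sum>n. ennreal (2 ^ n / fact n) * (\<integral>\<^sup>+y. ennreal (norm (gamma_spike k (Complex (real n / 2) y)) powr q) \<partial>lborel))"
    by (rule nn_integral_omega) measurable
  also have "\<dots> = (\<Sum>n\<in>{2 * k}. ennreal (2 ^ n / fact n) * (\<integral>\<^sup>+y. ennreal (norm (gamma_spike k (Complex (real n / 2) y)) powr q) \<partial>lborel))"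
    using q by (intro suminf_finite) (auto simp: gamma_spike_def field_simps)
  also have "\<dots> = ennreal (1 / a) * (\<integral>\<^sup>+y. ennreal (a powr q) * ennreal (norm (Gamma (Complex 1 y)) powr q) \<partial>lborel)"
    using a by (simp add: gamma_spike_def norm_mult powr_mult ennreal_mult flip: a_def) (simp add: a_def)
  also have "\<dots> = ennreal (1 / a * a powr q) * (\<integral>\<^sup>+y. ennreal (norm (Gamma (Complex 1 y)) powr q) \<partial>lborel)"
    using a by (simp add: nn_integral_cmult ennreal_mult mult.assoc del: times_divide_eq_left)
  also have "1 / a * a powr q = a powr (q - 1)"
    using a by (simp add: powr_diff)
  finally show ?thesis by (simp add: a_def)
qed

lemma integrable_Gamma_line_powr:
  assumes q: "q \<ge> 1"
  shows "integrable lborel (\<lambda>y. norm (Gamma (Complex 1 y)) powr q)"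
proof (rule Bochner_Integration.integrable_bound)
  let ?c = "(2 * Gamma (3::real)) powr q"
  have [measurable]: "(\<lambda>y. Gamma (Complex 1 y)) \<in> borel_measurable borel"
    by (intro borel_measurable_continuous_onI Gamma_line_continuous)
  show "(\<lambda>y. norm (Gamma (Complex 1 y)) powr q) \<in> borel_measurable lborel"
    by measurable
  show "integrable lborel (\<lambda>y. ?c * (1 / (1 + y\<^sup>2)))"
    by (intro integrable_mult_right integrable_cauchy_density)
  show "AE y in lborel. norm (norm (Gamma (Complex 1 y)) powr q) \<le> norm (?c * (1 / (1 + y\<^sup>2)))"
  proof (rule AE_I2)
    fix y :: real
    define w where "w = 1 / (1 + y\<^sup>2)"
    have pos: "1 + y\<^sup>2 > 0" by (simp add: add_pos_nonneg)
    have w: "0 < w" "w \<le> 1" using pos by (auto simp: w_def)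
    have "norm (Gamma (Complex 1 y)) \<le> 2 * Gamma 3 * w"
      using norm_Gamma_decay[of 1 y] by (simp add: w_def)
    then have "norm (Gamma (Complex 1 y)) powr q \<le> (2 * Gamma 3 * w) powr q"
      using q by (intro powr_mono2) auto
    also have "\<dots> = ?c * w powr q"
      using w by (simp add: powr_mult Gamma_real_pos less_imp_le)
    also have "\<dots> \<le> ?c * w powr 1"
      using w q by (intro mult_left_mono powr_mono') auto
    finally show "norm (norm (Gamma (Complex 1 y)) powr q) \<le> norm (?c * (1 / (1 + y\<^sup>2)))"
      using w by (simp add: w_def)
  qed
qed

text \<open>The exponent \<open>q - 1\<close> arises because the normalising constant enters to the power \<open>q\<close>, and
  the weight of the line, which is its reciprocal, once.\<close>

lemma gamma_spike_Lp:
  assumes q: "q \<ge> 1"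
  shows "gamma_spike k \<in> Lp q omega"
    and "(\<integral>z. norm (gamma_spike k z) powr q \<partial>omega)
      = (fact (2 * k) / 2 ^ (2 * k)) powr (q - 1) * (LINT y|lborel. norm (Gamma (Complex 1 y)) powr q)"
proof -
  let ?r = "(fact (2 * k) / 2 ^ (2 * k)) powr (q - 1) * (LINT y|lborel. norm (Gamma (Complex 1 y)) powr q)"
  have "(\<integral>\<^sup>+y. ennreal (norm (Gamma (Complex 1 y)) powr q) \<partial>lborel)
      = ennreal (LINT y|lborel. norm (Gamma (Complex 1 y)) powr q)"
    using q by (intro nn_integral_eq_integral integrable_Gamma_line_powr) auto
  then have nn: "(\<integral>\<^sup>+z. ennreal (norm (gamma_spike k z) powr q) \<partial>omega) = ennreal ?r"
    using q by (simp add: nn_integral_gamma_spike ennreal_mult)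
  have m [measurable]: "gamma_spike k \<in> borel_measurable omega"
    by (rule measurable_omega_I) measurable
  have "integrable omega (\<lambda>z. norm (gamma_spike k z) powr q)"
    using nn by (intro integrableI_bounded) auto
  then show "gamma_spike k \<in> Lp q omega"
    using m by (simp add: Lp_def)
  show "(\<integral>z. norm (gamma_spike k z) powr q \<partial>omega) = ?r"
    by (subst integral_eq_nn_integral) (auto simp: nn)
qed

lemma L2_inner_gamma_spike:
  assumes g: "g \<in> M_omega 2"
  shows "L2_inner omega (gamma_spike k) g = (LINT y|lborel. Gamma (Complex 1 y) * cnj (g (Complex (real k) y)))"
proof -
  have gL: "g \<in> Lp 2 omega" using g by (simp add: M_omega_def)
  have sp: "gamma_spike k \<in> Lp 2 omega" by (rule gamma_spike_Lp) simp
  let ?t = "\<lambda>n. (2 ^ n / fact n) *\<^sub>R (LINT y|lborel. gamma_spike k (Complex (real n / 2) y) * cnj (g (Complex (real n / 2) y)))"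
  have 1: "?t sums L2_inner omega (gamma_spike k) g"
    unfolding L2_inner_def by (rule integral_omega_sums[OF integrable_mult_cnj_Lp2[OF sp gL]])
  have 2: "?t sums (\<Sum>n\<in>{2 * k}. ?t n)"
    by (intro sums_finite) (auto simp: gamma_spike_def field_simps)
  have "(\<Sum>n\<in>{2 * k}. ?t n) = (LINT y|lborel. Gamma (Complex 1 y) * cnj (g (Complex (real k) y)))"
    by (simp add: gamma_spike_def mult.assoc scaleR_conv_of_real)
  with sums_unique2[OF 1 2] show ?thesis by (rule trans)
qed

lemma L2_inner_diff_left:
  assumes "f \<in> Lp 2 M" "h \<in> Lp 2 M" "g \<in> Lp 2 M"
  shows "L2_inner M (\<lambda>z. f z - h z) g = L2_inner M f g - L2_inner M h g"
  unfolding L2_inner_def using assms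
  by (simp add: left_diff_distrib integrable_mult_cnj_Lp2 Bochner_Integration.integral_diff)

lemma gamma_shift_orthogonal:
  assumes "g \<in> M_omega 2"
  shows "L2_inner omega (\<lambda>z. gamma_spike k z - gamma_shift k z) g = 0"
  using assms
  by (subst L2_inner_diff_left)
     (auto simp: gamma_spike_Lp gamma_shift_Lp2 L2_inner_gamma_spike L2_inner_gamma_shift M_omega_def)

text \<open>Uniqueness of orthogonal projections: two candidates \<open>h\<close>, \<open>h'\<close> satisfy \<open>\<langle>h, g\<rangle> = \<langle>h', g\<rangle>\<close> for
  all \<open>g\<close> in the subspace. Taking \<open>g = h\<close> and \<open>g = h'\<close> shows that \<open>h' - h\<close> has norm zero, without
  forming the difference inside the subspace. In particular the choice made in the definition of
  \<^term>\<open>omega_proj\<close> is identified as soon as one candidate is exhibited.\<close>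

lemma omega_proj_eq_AE:
  assumes f: "f \<in> Lp 2 omega" and h: "h \<in> M_omega 2"
    and orth: "\<And>g. g \<in> M_omega 2 \<Longrightarrow> L2_inner omega (\<lambda>z. f z - h z) g = 0"
  shows "AE z in omega. omega_proj f z = h z"
proof -
  define h' where "h' = omega_proj f"
  have "h' \<in> M_omega 2 \<and> (\<forall>g\<in>M_omega 2. L2_inner omega (\<lambda>z. f z - h' z) g = 0)"
    unfolding h'_def omega_proj_def by (rule someI[of _ h]) (use h orth in blast)
  then have h': "h' \<in> M_omega 2" and orth': "\<And>g. g \<in> M_omega 2 \<Longrightarrow> L2_inner omega (\<lambda>z. f z - h' z) g = 0"
    by auto
  have L: "g \<in> Lp 2 omega" if "g \<in> M_omega 2" for g using that by (simp add: M_omega_def)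
  have eq: "L2_inner omega h g = L2_inner omega h' g" if "g \<in> M_omega 2" for g
    using orth[OF that] orth'[OF that] L[OF that] L[OF h] L[OF h'] f by (simp add: L2_inner_diff_left)
  define d where "d z = h' z - h z" for z
  have [measurable]: "h \<in> borel_measurable omega" "h' \<in> borel_measurable omega"
    using L[OF h] L[OF h'] by (auto simp: Lp_def)
  have id: "integrable omega (\<lambda>z. h' z * cnj (h' z))" "integrable omega (\<lambda>z. h' z * cnj (h z))"
     "integrable omega (\<lambda>z. h z * cnj (h' z))" "integrable omega (\<lambda>z. h z * cnj (h z))"
    by (intro integrable_mult_cnj_Lp2 L h h')+
  have dd: "d z * cnj (d z) = (h' z * cnj (h' z) - h z * cnj (h' z)) - (h' z * cnj (h z) - h z * cnj (h z))" for z
    by (simp add: d_def algebra_simps)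
  have "(\<integral>z. d z * cnj (d z) \<partial>omega) = (L2_inner omega h' h' - L2_inner omega h h') - (L2_inner omega h' h - L2_inner omega h h)"
    unfolding dd L2_inner_def using id by simp
  also have "\<dots> = 0" using eq[OF h] eq[OF h'] by simp
  finally have "(\<integral>z. complex_of_real ((norm (d z))\<^sup>2) \<partial>omega) = 0"
    by (simp add: complex_norm_square flip: of_real_power)
  then have z: "(\<integral>z. (norm (d z))\<^sup>2 \<partial>omega) = 0"
    by (simp only: integral_complex_of_real of_real_eq_0_iff)
  have "integrable omega (\<lambda>z. d z * cnj (d z))"
    unfolding dd using id by simp
  then have "integrable omega (\<lambda>z. norm (d z * cnj (d z)))" by (rule integrable_norm)
  then have "integrable omega (\<lambda>z. (norm (d z))\<^sup>2)"
    by (simp add: norm_mult power2_eq_square)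
  then have "AE z in omega. (norm (d z))\<^sup>2 = 0"
    using z by (subst (asm) integral_nonneg_eq_0_iff_AE) auto
  then show ?thesis
    by (auto simp: d_def h'_def)
qed

section \<open>Factorial growth defeats every constant\<close>

lemma fact_square_ge: "fact (2 * n) / 2 ^ (2 * n) \<le> (fact n :: real)\<^sup>2"
proof -
  have "fact (2 * n) / (fact n)\<^sup>2 = real ((2 * n) choose n)"
    by (simp add: binomial_fact power2_eq_square)
  also have "\<dots> \<le> real (2 ^ (2 * n))"
    by (simp only: of_nat_le_iff binomial_le_pow2)
  finally show ?thesis by (simp add: field_simps)
qed

lemma fact_powr_not_geometric:
  fixes r M q :: real
  assumes "r > 0" "q > 0"
  shows "\<exists>n. fact n powr r > M * q ^ n"
proof (rule ccontr)
  assume "\<not> ?thesis"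
  then have le: "fact n powr r \<le> M * q ^ n" for n by (simp add: not_less)
  have M: "M \<ge> 1" using le[of 0] by simp
  define c where "c = q powr (1 / r)"
  define N where "N = M powr (1 / r)"
  have N: "N > 0" using M by (simp add: N_def)
  have "fact n \<le> N * c ^ n" for n
  proof -
    have "(fact n :: real) = (fact n powr r) powr (1 / r)"
      using assms by (simp add: powr_powr)
    also have "\<dots> \<le> (M * q ^ n) powr (1 / r)"
      using assms le by (intro powr_mono2) auto
    also have "\<dots> = N * (q ^ n) powr (1 / r)"
      using assms M by (simp add: powr_mult N_def)
    also have "(q ^ n) powr (1 / r) = c ^ n"
      using assms by (simp add: c_def powr_powr mult.commute flip: powr_realpow)
    finally show ?thesis .
  qed
  then have "1 / N \<le> c ^ n /\<^sub>R fact n" for n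
    using N by (simp add: field_simps)
  moreover have "(\<lambda>n. c ^ n /\<^sub>R fact n) \<longlonglongrightarrow> 0"
    using summable_exp_generic[of c] by (rule summable_LIMSEQ_zero)
  ultimately have "1 / N \<le> 0"
    by (intro LIMSEQ_le_const) auto
  then show False using N by simp
qed

text \<open>The contribution of the single line \<open>Re z = j\<close>.\<close>

lemma gamma_shift_Lp_lower_bound:
  assumes p: "p \<ge> 1" and int: "integrable omega (\<lambda>z. norm (gamma_shift k z) powr p)"
  shows "2 ^ (2 * j) / fact (2 * j) * ((fact (k + j) * (1/3) ^ (k + j + 1)) powr p
      * (LINT y|lborel. norm (Gamma (Complex 1 y)) powr p))
    \<le> (\<integral>z. norm (gamma_shift k z) powr p \<partial>omega)"
proof -
  let ?K = "LINT y|lborel. norm (Gamma (Complex 1 y)) powr p"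
  let ?c = "fact (k + j) * (1/3 :: real) ^ (k + j + 1)"
  let ?t = "\<lambda>n. ennreal (2 ^ n / fact n) * (\<integral>\<^sup>+y. ennreal (norm (gamma_shift k (Complex (real n / 2) y)) powr p) \<partial>lborel)"
  have lb: "?c * norm (Gamma (Complex 1 y)) \<le> norm (gamma_shift k (Complex (real j) y))" for y
  proof -
    let ?s = "Complex (real (k + j) + 1) y"
    have s: "Complex (real j) y + of_nat k + 1 = ?s" by (simp add: complex_eq_iff)
    have "norm (gamma_shift k (Complex (real j) y)) = norm (Gamma ?s) * 3 powr - (real (k + j) + 1)"
      unfolding gamma_shift_def s norm_mult by (subst norm_powr_real_powr) auto
    also have "3 powr - (real (k + j) + 1) = (1/3 :: real) ^ (k + j + 1)"
    proof -
      have "3 powr - real (k + j + 1) = (1/3 :: real) ^ (k + j + 1)"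
        by (simp only: powr_minus powr_realpow power_one_over inverse_eq_divide zero_less_numeral)
      then show ?thesis by simp
    qed
    finally show ?thesis
      using mult_right_mono[OF norm_Gamma_vertical_line_ge[of "k + j" y], of "(1/3 :: real) ^ (k + j + 1)"]
      by (simp add: mult_ac)
  qed
  have "ennreal (2 ^ (2 * j) / fact (2 * j) * (?c powr p * ?K))
      = ennreal (2 ^ (2 * j) / fact (2 * j)) * ennreal (LINT y|lborel. ?c powr p * norm (Gamma (Complex 1 y)) powr p)"
    by (subst ennreal_mult[symmetric]) auto
  also have "ennreal (LINT y|lborel. ?c powr p * norm (Gamma (Complex 1 y)) powr p)
      = (\<integral>\<^sup>+y. ennreal (?c powr p * norm (Gamma (Complex 1 y)) powr p) \<partial>lborel)"
    using p by (intro nn_integral_eq_integral[symmetric] integrable_mult_right integrable_Gamma_line_powr) auto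
  also have "\<dots> \<le> (\<integral>\<^sup>+y. ennreal (norm (gamma_shift k (Complex (real j) y)) powr p) \<partial>lborel)"
  proof (intro nn_integral_mono ennreal_leI)
    fix y
    have "?c powr p * norm (Gamma (Complex 1 y)) powr p = (?c * norm (Gamma (Complex 1 y))) powr p"
      by (subst powr_mult; simp)
    also have "\<dots> \<le> norm (gamma_shift k (Complex (real j) y)) powr p"
      using p lb[of y] by (intro powr_mono2) auto
    finally show "?c powr p * norm (Gamma (Complex 1 y)) powr p \<le> norm (gamma_shift k (Complex (real j) y)) powr p" .
  qed
  finally have "ennreal (2 ^ (2 * j) / fact (2 * j) * (?c powr p * ?K)) \<le> ?t (2 * j)"
    by (simp add: mult_left_mono)
  also have "\<dots> \<le> (\<Sum>n. ?t n)"
    using sum_le_suminf[of ?t "{2 * j}"] by simp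
  also have "\<dots> = (\<integral>\<^sup>+z. ennreal (norm (gamma_shift k z) powr p) \<partial>omega)"
    by (rule nn_integral_omega_lines[where c = "\<lambda>t. ennreal (t powr p)", symmetric])
       (auto simp: gamma_shift_measurable_omega)
  also have "\<dots> = ennreal (\<integral>z. norm (gamma_shift k z) powr p \<partial>omega)"
    using int by (intro nn_integral_eq_integral) auto
  finally show ?thesis
    by (subst (asm) ennreal_le_iff) auto
qed

lemma integral_Gamma_line_powr_pos:
  assumes "q \<ge> 1"
  shows "(LINT y|lborel. norm (Gamma (Complex 1 y)) powr q) > 0"
proof -
  have nz: "Gamma (Complex 1 y) \<noteq> 0" for y
  proof -
    have "Complex 1 y \<notin> \<int>\<^sub>\<le>\<^sub>0"
      by (auto elim!: nonpos_Ints_cases simp: complex_eq_iff)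
    then show ?thesis by (simp add: Gamma_eq_zero_iff)
  qed
  have "(LINT y|lborel. norm (Gamma (Complex 1 y)) powr q) \<noteq> 0"
  proof
    assume "(LINT y|lborel. norm (Gamma (Complex 1 y)) powr q) = 0"
    then have "AE y in lborel. norm (Gamma (Complex 1 y)) powr q = 0"
      using assms by (subst (asm) integral_nonneg_eq_0_iff_AE) (auto intro: integrable_Gamma_line_powr)
    then have "AE y in (lborel :: real measure). False" using nz by simp
    then show False by (simp add: eventually_False ae_filter_eq_bot_iff)
  qed
  moreover have "(LINT y|lborel. norm (Gamma (Complex 1 y)) powr q) \<ge> 0"
    by simp
  ultimately show ?thesis by linarith
qed

text \<open>Testing the bound on \<open>gamma_spike k\<close> and keeping one line \<open>Re z = j\<close> of the image bounds
  \<open>(k + j)!\<close> to the power \<open>p\<close> by a geometric sequence times \<open>(j!)\<^sup>2\<close> and \<open>k!\<close> to the power \<open>2(p - 1)\<close>.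
  The choice \<open>j = 0\<close> is contradictory for \<open>p < 2\<close>, and \<open>k = 0\<close> for \<open>p > 2\<close>.\<close>

theorem theorem8:
  fixes p :: real
  assumes "1 \<le> p" and "p \<noteq> 2"
  shows "\<not> (\<exists>C::real. \<forall>f \<in> Lp p omega \<inter> Lp 2 omega.
           omega_proj f \<in> M_omega p \<and>
           Lp_norm p omega (omega_proj f) \<le> C * Lp_norm p omega f)"
proof
  assume "\<exists>C::real. \<forall>f \<in> Lp p omega \<inter> Lp 2 omega.
           omega_proj f \<in> M_omega p \<and>
           Lp_norm p omega (omega_proj f) \<le> C * Lp_norm p omega f"
  then obtain C where C: "\<And>f. f \<in> Lp p omega \<Longrightarrow> f \<in> Lp 2 omega \<Longrightarrow>
       omega_proj f \<in> M_omega p \<and> Lp_norm p omega (omega_proj f) \<le> C * Lp_norm p omega f"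
    by blast
  define K where "K = (LINT y|lborel. norm (Gamma (Complex 1 y)) powr p)"
  have K: "K > 0" unfolding K_def using assms by (intro integral_Gamma_line_powr_pos)
  define C' where "C' = max C 0"
  define a :: "nat \<Rightarrow> real" where "a k = fact (2 * k) / 2 ^ (2 * k)" for k
  have a: "a k > 0" "a k \<le> (fact k)\<^sup>2" for k
    using fact_square_ge[of k] by (auto simp: a_def)
  have key: "(fact (k + j) * (1/3) ^ (k + j + 1)) powr p \<le> C' powr p * a k powr (p - 1) * a j" for k j
  proof -
    define I where "I = (\<integral>z. norm (gamma_spike k z) powr p \<partial>omega)"
    define J where "J = (\<integral>z. norm (gamma_shift k z) powr p \<partial>omega)"
    have I: "I = a k powr (p - 1) * K"
      unfolding I_def a_def K_def using assms by (intro gamma_spike_Lp)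
    have f: "gamma_spike k \<in> Lp p omega" "gamma_spike k \<in> Lp 2 omega"
      using assms by (auto intro: gamma_spike_Lp)
    note Cf = C[OF f]
    have AE: "AE z in omega. omega_proj (gamma_spike k) z = gamma_shift k z"
      by (intro omega_proj_eq_AE f gamma_shift_in_M_omega gamma_shift_orthogonal)
    have Pm [measurable]: "omega_proj (gamma_spike k) \<in> borel_measurable omega"
      and Pi: "integrable omega (\<lambda>z. norm (omega_proj (gamma_spike k) z) powr p)"
      using Cf by (auto simp: M_omega_def Lp_def)
    note [measurable] = gamma_shift_measurable_omega[of k]
    have AE': "AE z in omega. norm (omega_proj (gamma_spike k) z) powr p = norm (gamma_shift k z) powr p"
      using AE by eventually_elim simp
    have int: "integrable omega (\<lambda>z. norm (gamma_shift k z) powr p)"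
      by (rule integrable_cong_AE_imp[OF Pi]) (use AE' in \<open>auto elim: eventually_mono\<close>)
    have J: "J = (\<integral>z. norm (omega_proj (gamma_spike k) z) powr p \<partial>omega)"
      unfolding J_def by (rule integral_cong_AE) (use AE' in \<open>auto elim: eventually_mono\<close>)
    have nn: "I \<ge> 0" "J \<ge> 0" by (auto simp: I_def J_def)
    have "J powr (1 / p) \<le> C * I powr (1 / p)"
      using Cf by (simp add: Lp_norm_def I_def J)
    also have "\<dots> \<le> C' * I powr (1 / p)"
      by (intro mult_right_mono) (auto simp: C'_def)
    finally have "(J powr (1 / p)) powr p \<le> (C' * I powr (1 / p)) powr p"
      using assms by (intro powr_mono2) auto
    then have "J \<le> C' powr p * I"
      using assms nn by (simp add: powr_mult powr_powr C'_def)
    moreover have "1 / a j * ((fact (k + j) * (1/3) ^ (k + j + 1)) powr p * K) \<le> J"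
      using gamma_shift_Lp_lower_bound[OF assms(1) int, of j] by (simp add: a_def J_def K_def)
    ultimately have "1 / a j * ((fact (k + j) * (1/3) ^ (k + j + 1)) powr p * K) \<le> C' powr p * (a k powr (p - 1) * K)"
      by (simp add: I)
    then have "(1 / a j * (fact (k + j) * (1/3) ^ (k + j + 1)) powr p) * K \<le> (C' powr p * a k powr (p - 1)) * K"
      by (simp only: mult.assoc)
    then have "1 / a j * (fact (k + j) * (1/3) ^ (k + j + 1)) powr p \<le> C' powr p * a k powr (p - 1)"
      using K by (simp only: mult_le_cancel_right_pos)
    then show ?thesis
      using a(1)[of j] by (simp add: field_simps)
  qed
  have "\<exists>r M. r > 0 \<and> (\<forall>n. fact n powr r \<le> M * (3 powr p) ^ n)"
  proof -
    have split: "(fact n * (1/3) ^ (n + 1)) powr p = fact n powr p / (3 powr p * (3 powr p) ^ n)" for n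
    proof -
      have "((1/3 :: real) ^ (n + 1)) powr p = ((1/3) powr p) ^ (n + 1)"
      proof -
        have "((1/3 :: real) ^ (n + 1)) powr p = ((1/3) powr real (n + 1)) powr p"
          by (subst powr_realpow) auto
        also have "\<dots> = ((1/3) powr p) powr real (n + 1)"
          by (simp only: powr_powr mult.commute)
        also have "\<dots> = ((1/3) powr p) ^ (n + 1)"
          by (subst powr_realpow) auto
        finally show ?thesis .
      qed
      then show ?thesis by (simp add: powr_mult powr_divide power_divide)
    qed
    have pos: "(3 powr p * (3 powr p) ^ n) > 0" for n by simp
    have a0: "a 0 = 1" by (simp add: a_def)
    consider "p < 2" | "p > 2" using assms by linarith
    then show ?thesis
    proof cases
      case 1
      have "fact n powr (2 - p) \<le> (C' powr p * 3 powr p) * (3 powr p) ^ n" for n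
      proof -
        have "fact n powr p / (3 powr p * (3 powr p) ^ n) \<le> C' powr p * a n powr (p - 1)"
          using key[of n 0] unfolding add_0_right split by (simp add: a0)
        also have "a n powr (p - 1) \<le> ((fact n)\<^sup>2) powr (p - 1)"
          using assms a[of n] by (intro powr_mono2) auto
        also have "((fact n)\<^sup>2 :: real) powr (p - 1) = fact n powr (2 * (p - 1))"
          by (simp add: powr_powr flip: powr_numeral)
        finally have "fact n powr p / (3 powr p * (3 powr p) ^ n) \<le> C' powr p * fact n powr (2 * (p - 1))"
          by (auto simp: mult_left_mono)
        then have "fact n powr p \<le> (C' powr p * 3 powr p) * (3 powr p) ^ n * fact n powr (2 * (p - 1))"
          by (simp add: pos_divide_le_eq mult_ac)
        moreover have "fact n powr p = fact n powr (2 - p) * fact n powr (2 * (p - 1))"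
          by (simp flip: powr_add)
        ultimately show ?thesis by (simp add: mult_le_cancel_right)
      qed
      then show ?thesis using 1 by (intro exI[of _ "2 - p"] exI[of _ "C' powr p * 3 powr p"]) auto
    next
      case 2
      have "fact n powr (p - 2) \<le> (C' powr p * 3 powr p) * (3 powr p) ^ n" for n
      proof -
        have "fact n powr p / (3 powr p * (3 powr p) ^ n) \<le> C' powr p * a n"
          using key[of 0 n] unfolding add_0_left split by (simp add: a0)
        also have "\<dots> \<le> C' powr p * (fact n)\<^sup>2"
          using a[of n] by (intro mult_left_mono) auto
        finally have "fact n powr p \<le> (C' powr p * 3 powr p) * (3 powr p) ^ n * (fact n)\<^sup>2"
          by (simp add: pos_divide_le_eq mult_ac)
        moreover have "fact n powr p = fact n powr (p - 2) * (fact n)\<^sup>2"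
          by (simp add: powr_diff)
        ultimately show ?thesis by (simp add: mult_le_cancel_right)
      qed
      then show ?thesis using 2 by (intro exI[of _ "p - 2"] exI[of _ "C' powr p * 3 powr p"]) auto
    qed
  qed
  then obtain r M where "r > 0" "\<And>n. fact n powr r \<le> M * (3 powr p) ^ n" by blast
  then show False
    using fact_powr_not_geometric[of r "3 powr p" M] by (auto simp: not_less[symmetric])
qed

end
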